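(* Let $\alpha,\beta,\gamma,\rho,a\in\mathbb{C}$ with $a\ne0$, and let $\mu$ be a real number, such that $\operatorname{Re}(\alpha)>0$, $\mu>0$ and $\operatorname{Re}(\rho)>\max\{\operatorname{Re}(-\beta),\operatorname{Re}(-\gamma)\}$. Then for every $x>0$, $$\left(\mathcal{I}_{-}^{\alpha,\beta,\gamma}\left(t^{-\rho}I^{m,n}_{p,q}\left[at^{-\mu}\,\middle|\begin{matrix}(a_i,A_i,\alpha_i)_{1,p}\\(b_j,B_j,\beta_j)_{1,q}\end{matrix}\right]\right)\right)(x)=x^{-\beta-\rho}\,I^{m,n+2}_{p+2,q+2}\left[ax^{-\mu}\,\middle|\begin{matrix}(1-\gamma-\rho,\mu,1),\ (1-\beta-\rho,\mu,1),\ (a_i,A_i,\alpha_i)_{1,p}\\(b_j,B_j,\beta_j)_{1,q},\ (1-\rho,\mu,1),\ (1-\alpha-\beta-\gamma-\rho,\mu,1)\end{matrix}\right].$$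
   Context: **$I$-function.** Let $m,n,p,q$ be integers with $0\le m\le q$, $0\le n\le p$; let $a_i\in\mathbb{C}$, $A_i,\alpha_i>0$ $(1\le i\le p)$ and $b_j\in\mathbb{C}$, $B_j,\beta_j>0$ $(1\le j\le q)$. For $z\neq0$ (with a chosen value of $\arg z$; $z^{-s}=e^{-s(\log|z|+i\arg z)}$), $$I^{m,n}_{p,q}\left[z\,\middle|\begin{matrix}(a_i,A_i,\alpha_i)_{1,p}\\(b_j,B_j,\beta_j)_{1,q}\end{matrix}\right]=\frac{1}{2\pi i}\int_{C}\chi(s)z^{-s}\,ds,\qquad \chi(s)=\frac{\prod_{j=1}^{m}\Gamma^{\beta_j}(b_j+B_js)\prod_{i=1}^{n}\Gamma^{\alpha_i}(1-a_i-A_is)}{\prod_{j=m+1}^{q}\Gamma^{\beta_j}(1-b_j-B_js)\prod_{i=n+1}^{p}\Gamma^{\alpha_i}(a_i+A_is)}.$$ Here $(a_i,A_i,\alpha_i)_{1,p}$ is the ordered list of triples for $i=1,\dots,p$ (the first $n$ upper triples and the first $m$ lower triples enter the numerator), $\Gamma^{\kappa}(w)=(\Gamma(w))^{\kappa}$, with the branch of non-integer powers fixed along $C$ and the same for the same triple in all $I$-functions considered; empty products equal $1$. The singularities of $\Gamma^{\beta_j}(b_j+B_js)$, $j\le m$, lie to the left of $C$ and those of $\Gamma^{\alpha_i}(1-a_i-A_is)$, $i\le n$, to the right. **Standing assumptions.** The contour $C$ is the imaginary axis $\operatorname{Re}(s)=0$, traversed upwards, and for each $I$-function occurring the following conditions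 for absolute convergence hold: with (computed from the parameters of that $I$-function) $\mu^*=\sum_{j=1}^q\beta_jB_j-\sum_{i=1}^p\alpha_iA_i$, $\Omega=\sum_{i=1}^p(\frac12-\operatorname{Re}(a_i))\alpha_i-\sum_{j=1}^q(\frac12-\operatorname{Re}(b_j))\beta_j$, $\Delta=\sum_{j=1}^m\beta_jB_j-\sum_{j=m+1}^q\beta_jB_j+\sum_{i=1}^n\alpha_iA_i-\sum_{i=n+1}^p\alpha_iA_i$, either $\Delta>0$ and $|\arg z|<\frac{\pi}{2}\Delta$, or $\Delta\ge0$, $|\arg z|=\frac{\pi}{2}\Delta$ and one of: $\mu^*=0$ and $\Omega<-1$; or $\mu^*\ne0$ and $\Omega+\sigma\mu^*<-1$ where $\sigma=\operatorname{Re}(s)$ on $C$ (so $\sigma=0$). For $t>0$, $\arg(at^{\pm\mu})=\arg a$. **Operator.** For $\operatorname{Re}(\alpha)>0$, $x>0$, the right-sided Saigo (generalized) fractional integral is $$\left(\mathcal{I}_{-}^{\alpha,\beta,\gamma}f\right)(x)=\frac{1}{\Gamma(\alpha)}\int_x^{\infty}(t-x)^{\alpha-1}t^{-\alpha-\beta}{}_{2}F_1\left(\alpha+\beta,-\gamma;\alpha;1-\tfrac{x}{t}\right)f(t)\,dt.$$ *)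

theory Defs
  imports "HOL-Analysis.Analysis"
begin

text \<open>
  A parameter triple \<open>(c, A, \<kappa>)\<close> has a complex first entry and two real entries.  A list of triples
  carries its own length, so \<open>p = length as\<close> and \<open>q = length bs\<close> for the upper list \<open>as\<close> and the
  lower list \<open>bs\<close>.
\<close>

type_synonym triple = "complex \<times> real \<times> real"

text \<open>
  Branches of \<open>\<Gamma>\<^sup>\<kappa>(c + d s)\<close> along the contour \<open>Re s = 0\<close> are given by a choice \<open>\<Lambda> c d \<kappa>\<close> of a
  continuous logarithm of \<open>\<Gamma>(c + d s)\<close> there.  The choice depends on \<open>(c, d, \<kappa>)\<close> only, hence only
  on the triple, not on its position or on the \<open>I\<close>-function in which it occurs.
  (Arguments \<open>1 - c - A s\<close> have \<open>d = - A < 0\<close>, arguments \<open>c + A s\<close> have \<open>d = A > 0\<close>.)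
\<close>

definition log_Gamma_branch :: "(complex \<Rightarrow> real \<Rightarrow> real \<Rightarrow> complex \<Rightarrow> complex) \<Rightarrow> bool" where
  "log_Gamma_branch \<Lambda> \<longleftrightarrow>
     (\<forall>c d \<kappa>. d \<noteq> 0 \<longrightarrow>
        (let S = {s. Re s = 0 \<and> c + of_real d * s \<notin> \<int>\<^sub>\<le>\<^sub>0} in
           continuous_on S (\<Lambda> c d \<kappa>) \<and>
           (\<forall>s\<in>S. exp (\<Lambda> c d \<kappa> s) = Gamma (c + of_real d * s))))"

text \<open>
  A pole of \<open>\<Gamma>\<close> can lie on the contour only for a denominator factor of \<open>\<chi>\<close>.  There the value \<open>0\<close>
  together with \<open>x / 0 = 0\<close> gives the correct value \<open>1 / \<Gamma>\<^sup>\<kappa> = 0\<close>.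
\<close>

definition Gamma_pow ::
  "(complex \<Rightarrow> real \<Rightarrow> real \<Rightarrow> complex \<Rightarrow> complex) \<Rightarrow> complex \<Rightarrow> real \<Rightarrow> real \<Rightarrow> complex \<Rightarrow> complex" where
  "Gamma_pow \<Lambda> c d \<kappa> s =
     (if c + of_real d * s \<in> \<int>\<^sub>\<le>\<^sub>0 then 0 else exp (of_real \<kappa> * \<Lambda> c d \<kappa> s))"

definition I_kernel ::
  "(complex \<Rightarrow> real \<Rightarrow> real \<Rightarrow> complex \<Rightarrow> complex) \<Rightarrow> nat \<Rightarrow> nat \<Rightarrow> triple list \<Rightarrow> triple list \<Rightarrow>
     complex \<Rightarrow> complex" where
  "I_kernel \<Lambda> m n as bs s =
     ((\<Prod>(b, B, \<beta>)\<leftarrow>take m bs. Gamma_pow \<Lambda> b B \<beta> s) *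
      (\<Prod>(a, A, \<alpha>)\<leftarrow>take n as. Gamma_pow \<Lambda> (1 - a) (- A) \<alpha> s)) /
     ((\<Prod>(b, B, \<beta>)\<leftarrow>drop m bs. Gamma_pow \<Lambda> (1 - b) (- B) \<beta> s) *
      (\<Prod>(a, A, \<alpha>)\<leftarrow>drop n as. Gamma_pow \<Lambda> a A \<alpha> s))"

text \<open>
  \<open>\<theta>\<close> is the chosen value of \<open>arg z\<close>, so that \<open>z\<^sup>-\<^sup>s = exp (- s (ln |z| + \<i> \<theta>))\<close>.  The contour integral is
  parametrised by \<open>s = \<i> \<tau>\<close>, \<open>ds = \<i> d\<tau>\<close>.
\<close>

definition I_function ::
  "(complex \<Rightarrow> real \<Rightarrow> real \<Rightarrow> complex \<Rightarrow> complex) \<Rightarrow> nat \<Rightarrow> nat \<Rightarrow> triple list \<Rightarrow> triple list \<Rightarrow>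
     complex \<Rightarrow> real \<Rightarrow> complex" where
  "I_function \<Lambda> m n as bs z \<theta> =
     1 / (2 * of_real pi * \<i>) *
     (LINT \<tau>|lborel.
        (let s = \<i> * of_real \<tau> in
           I_kernel \<Lambda> m n as bs s * exp (- s * (of_real (ln (cmod z)) + \<i> * of_real \<theta>)) * \<i>))"

definition I_mu_star :: "triple list \<Rightarrow> triple list \<Rightarrow> real" where
  "I_mu_star as bs = (\<Sum>(b, B, \<beta>)\<leftarrow>bs. \<beta> * B) - (\<Sum>(a, A, \<alpha>)\<leftarrow>as. \<alpha> * A)"

definition I_Omega :: "triple list \<Rightarrow> triple list \<Rightarrow> real" where
  "I_Omega as bs =
     (\<Sum>(a, A, \<alpha>)\<leftarrow>as. (1/2 - Re a) * \<alpha>) - (\<Sum>(b, B, \<beta>)\<leftarrow>bs. (1/2 - Re b) * \<beta>)"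

definition I_Delta :: "nat \<Rightarrow> nat \<Rightarrow> triple list \<Rightarrow> triple list \<Rightarrow> real" where
  "I_Delta m n as bs =
     (\<Sum>(b, B, \<beta>)\<leftarrow>take m bs. \<beta> * B) - (\<Sum>(b, B, \<beta>)\<leftarrow>drop m bs. \<beta> * B) +
     (\<Sum>(a, A, \<alpha>)\<leftarrow>take n as. \<alpha> * A) - (\<Sum>(a, A, \<alpha>)\<leftarrow>drop n as. \<alpha> * A)"

definition I_params :: "nat \<Rightarrow> nat \<Rightarrow> triple list \<Rightarrow> triple list \<Rightarrow> bool" where
  "I_params m n as bs \<longleftrightarrow>
     m \<le> length bs \<and> n \<le> length as \<and>
     (\<forall>(a, A, \<alpha>)\<in>set as. A > 0 \<and> \<alpha> > 0) \<and> (\<forall>(b, B, \<beta>)\<in>set bs. B > 0 \<and> \<beta> > 0)"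

definition I_separated :: "nat \<Rightarrow> nat \<Rightarrow> triple list \<Rightarrow> triple list \<Rightarrow> bool" where
  "I_separated m n as bs \<longleftrightarrow>
     (\<forall>(b, B, \<beta>)\<in>set (take m bs). \<forall>s. b + of_real B * s \<in> \<int>\<^sub>\<le>\<^sub>0 \<longrightarrow> Re s < 0) \<and>
     (\<forall>(a, A, \<alpha>)\<in>set (take n as). \<forall>s. 1 - a - of_real A * s \<in> \<int>\<^sub>\<le>\<^sub>0 \<longrightarrow> Re s > 0)"

text \<open>Here \<open>\<sigma> = 0\<close> is the constant value of \<open>Re s\<close> on the contour.\<close>

definition I_abs_conv :: "nat \<Rightarrow> nat \<Rightarrow> triple list \<Rightarrow> triple list \<Rightarrow> real \<Rightarrow> bool" where
  "I_abs_conv m n as bs \<theta> \<longleftrightarrow>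
     (let \<mu> = I_mu_star as bs; \<Omega> = I_Omega as bs; \<Delta> = I_Delta m n as bs; \<sigma> = (0::real) in
        (\<Delta> > 0 \<and> \<bar>\<theta>\<bar> < pi / 2 * \<Delta>) \<or>
        (\<Delta> \<ge> 0 \<and> \<bar>\<theta>\<bar> = pi / 2 * \<Delta> \<and>
          ((\<mu> = 0 \<and> \<Omega> < -1) \<or> (\<mu> \<noteq> 0 \<and> \<Omega> + \<sigma> * \<mu> < -1))))"

definition I_admissible :: "nat \<Rightarrow> nat \<Rightarrow> triple list \<Rightarrow> triple list \<Rightarrow> real \<Rightarrow> bool" where
  "I_admissible m n as bs \<theta> \<longleftrightarrow>
     I_params m n as bs \<and> I_separated m n as bs \<and> I_abs_conv m n as bs \<theta>"

definition Gauss_2F1 :: "complex \<Rightarrow> complex \<Rightarrow> complex \<Rightarrow> complex \<Rightarrow> complex" where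
  "Gauss_2F1 a b c z = eval_fps (fps_hypergeo [a, b] [c] 1) z"

text \<open>For \<open>t > x > 0\<close> the argument \<open>1 - x / t\<close> lies in the open unit disc, where the series suffices.\<close>

definition Saigo_right ::
  "complex \<Rightarrow> complex \<Rightarrow> complex \<Rightarrow> (real \<Rightarrow> complex) \<Rightarrow> real \<Rightarrow> complex" where
  "Saigo_right \<alpha> \<beta> \<gamma> f x =
     1 / Gamma \<alpha> *
     (LINT t:{x<..}|lborel.
        of_real (t - x) powr (\<alpha> - 1) * of_real t powr (- \<alpha> - \<beta>) *
        Gauss_2F1 (\<alpha> + \<beta>) (- \<gamma>) \<alpha> (of_real (1 - x / t)) * f t)"

end

theory Submission
  imports Defs "HOL-Real_Asymp.Real_Asymp"
begin

text \<open>
  On the contour, \<open>(a t\<^sup>-\<^sup>\<mu>)\<close> to the power \<open>- s\<close> is \<open>a\<close> to the power \<open>- s\<close> times \<open>t\<close> to the power \<open>\<mu> s\<close>.  So the function to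
  which the Saigo operator is applied is a superposition over \<open>s\<close> of the powers \<open>t\<close> to the \<open>- r\<close>, where
  \<open>r = \<rho> - \<mu> s\<close>.  The operator maps such a power to \<open>x\<close> to the power \<open>- \<beta> - r\<close> times
  \<open>\<Gamma>(\<beta> + r) \<Gamma>(\<gamma> + r) / (\<Gamma>(r) \<Gamma>(\<alpha> + \<beta> + \<gamma> + r))\<close>, and this multiplier is exactly what the four additional
  triples contribute to the kernel (\<open>I_kernel_extended\<close>).  The theorem is therefore an interchange of
  two integrals.  On \<open>Re s = 0\<close> the modulus of \<open>t\<close> to the power \<open>- r\<close> does not depend on \<open>s\<close>, so the modulus of
  the double integrand is a function of \<open>t\<close> times a function of \<open>s\<close>, and Fubini's theorem applies as
  soon as both are integrable.

  Integrability in \<open>t\<close>, together with the value of the integral, is \<open>Saigo_weight_power_integral\<close>.  The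
  substitution \<open>u = 1 - x / t\<close> gives an Euler integral of a hypergeometric function; termwise
  integration against the Beta integral (\<open>hyp_Euler_integral\<close>) gives a hypergeometric series at
  argument 1, which Gauss's theorem (\<open>Gauss_summation\<close>) evaluates.  Gauss's theorem follows from the
  contiguous relation between \<open>c\<close> and \<open>c + 1\<close> by letting the lower parameter tend to infinity.

  Integrability in \<open>s\<close> is \<open>integrable_I_kernel\<close>.  It needs the behaviour of \<open>|\<Gamma>|\<close> on vertical lines,
  \<open>|\<Gamma>(\<sigma> + \<i> y)|\<close> being of order \<open>|y|\<close> to the power \<open>\<sigma> - 1/2\<close> times \<open>exp (- \<pi> |y| / 2)\<close>.  For \<open>\<sigma> = 1/2\<close> this is the
  reflection formula.  In general, \<open>\<Gamma>(\<sigma>) / |\<Gamma>(\<sigma> + \<i> y)|\<close> is a limit of products of log-convex functions of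
  \<open>\<sigma>\<close>, so one may interpolate between the lines \<open>1/2\<close> and \<open>3/2\<close> and reach the remaining lines by the
  recurrence (\<open>rGamma_vertical_bound\<close>, \<open>Gamma_vertical_bound\<close>).  Multiplied together, these bounds give the
  order \<open>\<Omega>\<close> and the rate \<open>\<Delta>\<close> of the kernel, for which the convergence conditions are stated.
\<close>

section \<open>The Gamma function on vertical lines\<close>

text \<open>
  Half of this function is the logarithm of \<open>|u + \<i> y| / u\<close>, the modulus of one factor of the Gamma
  product.  The second derivative equals \<open>2 (3 u\<^sup>2 y\<^sup>2 + y\<^sup>4) / (u\<^sup>2 (u\<^sup>2 + y\<^sup>2)\<^sup>2)\<close>.
\<close>

lemma convex_log_one_plus_square_over:
  fixes y :: real
  shows "convex_on {0<..} (\<lambda>u. ln (u^2 + y^2) - 2 * ln u)"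
proof (rule f''_ge0_imp_convex)
  show "convex {0::real<..}" by simp
  fix u :: real assume "u \<in> {0<..}"
  then have u: "u > 0" "u^2 + y^2 > 0" by (auto intro: add_pos_nonneg)
  show "((\<lambda>u. ln (u^2 + y^2) - 2 * ln u) has_real_derivative 2 * u / (u^2 + y^2) - 2 / u) (at u)"
    using u by (auto intro!: derivative_eq_intros simp: field_simps)
  show "((\<lambda>u. 2 * u / (u^2 + y^2) - 2 / u) has_real_derivative
           (2 * (u^2 + y^2) - 2 * u * (2 * u)) / (u^2 + y^2)^2 + 2 / u^2) (at u)"
    using u by (auto intro!: derivative_eq_intros simp: field_simps power2_eq_square)
  have "(2 * (u^2 + y^2) - 2 * u * (2 * u)) / (u^2 + y^2)^2 + 2 / u^2
      = 2 * (3 * u^2 * y^2 + y^4) / ((u^2 + y^2)^2 * u^2)"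
    using u by (simp add: divide_simps) algebra
  also have "\<dots> \<ge> 0" by simp
  finally show "(2 * (u^2 + y^2) - 2 * u * (2 * u)) / (u^2 + y^2)^2 + 2 / u^2 \<ge> 0" .
qed

lemma norm_over_re_log_convex:
  fixes u v w y :: real
  assumes "u > 0" "v > 0" "0 \<le> w" "w \<le> 1"
  defines "q \<equiv> (\<lambda>t. cmod (Complex t y) / t)"
  shows "q ((1 - w) * u + w * v) \<le> q u powr (1 - w) * q v powr w"
proof -
  let ?L = "\<lambda>u. ln (u^2 + y^2) - 2 * ln u"
  have *: "q t = exp (?L t / 2)" if "t > 0" for t
  proof -
    have "t^2 + y^2 > 0" using that by (auto intro: add_pos_nonneg)
    then have "q t = exp (ln (sqrt (t^2 + y^2))) / exp (ln t)"
      using that by (simp add: q_def cmod_def)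
    also have "\<dots> = exp (?L t / 2)"
      using \<open>t^2 + y^2 > 0\<close> by (simp add: ln_sqrt exp_diff diff_divide_distrib)
    finally show ?thesis .
  qed
  have uv: "(1 - w) * u + w * v > 0"
    using assms by (smt (verit, best) mult_nonneg_nonneg mult_pos_pos)
  have "?L ((1 - w) * u + w * v) \<le> (1 - w) * ?L u + w * ?L v"
    using convex_onD[OF convex_log_one_plus_square_over[of y], of w u v] assms by simp
  then show ?thesis
    unfolding *[OF uv] *[OF assms(1)] *[OF assms(2)]
    by (simp add: powr_def flip: exp_add)
qed

text \<open>
  The quotient \<open>\<Gamma>(s) / |\<Gamma>(s + \<i> y)|\<close>.  Normalising by \<open>\<Gamma>(s)\<close> removes the factors \<open>n! n\<^sup>s\<close> from Euler's
  limit, which leaves a product of the log-convex terms \<open>|s + k + \<i> y| / (s + k)\<close>.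
\<close>

definition Gamma_line_ratio :: "real \<Rightarrow> real \<Rightarrow> real" where
  "Gamma_line_ratio y s = cmod (rGamma (Complex s y)) * Gamma s"

lemma norm_rGamma_series:
  "cmod (rGamma_series z N) = (\<Prod>k\<le>N. cmod (z + of_nat k)) / (fact N * exp (Re z * ln (real N)))"
  by (simp add: rGamma_series_def norm_divide norm_mult pochhammer_Suc_prod prod_norm[symmetric]
      atLeast0AtMost)

lemma Gamma_line_ratio_limit:
  assumes "s > 0"
  shows "(\<lambda>N. \<Prod>k\<le>N. cmod (Complex (s + real k) y) / (s + real k)) \<longlonglongrightarrow> Gamma_line_ratio y s"
proof -
  have s: "s \<notin> \<int>\<^sub>\<le>\<^sub>0" using assms by (auto elim!: nonpos_Ints_cases)
  then have "rGamma s \<noteq> 0" by (simp add: rGamma_eq_zero_iff)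
  then have "(\<lambda>N. cmod (rGamma_series (Complex s y) N) / rGamma_series s N)
      \<longlonglongrightarrow> cmod (rGamma (Complex s y)) / rGamma s"
    by (intro tendsto_intros)
  also have "cmod (rGamma (Complex s y)) / rGamma s = Gamma_line_ratio y s"
    by (simp add: Gamma_line_ratio_def Gamma_def divide_inverse)
  also have "(\<lambda>N. cmod (rGamma_series (Complex s y) N) / rGamma_series s N)
      = (\<lambda>N. \<Prod>k\<le>N. cmod (Complex (s + real k) y) / (s + real k))"
  proof
    fix N
    have "Complex s y + of_nat k = Complex (s + real k) y" for k
      by (simp add: complex_eq_iff)
    then show "cmod (rGamma_series (Complex s y) N) / rGamma_series s N
      = (\<Prod>k\<le>N. cmod (Complex (s + real k) y) / (s + real k))"
      unfolding norm_rGamma_series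
      by (simp add: rGamma_series_def pochhammer_Suc_prod atLeast0AtMost prod_dividef)
  qed
  finally show ?thesis .
qed

text \<open>
  Log-convexity in \<open>s\<close> passes from the finite products to their limit.  It lets the two lines on which
  \<open>|\<Gamma>|\<close> is elementary control all lines between them.
\<close>

lemma Gamma_line_ratio_log_convex:
  fixes u v w y :: real
  assumes "u > 0" "v > 0" "0 \<le> w" "w \<le> 1"
  shows "Gamma_line_ratio y ((1 - w) * u + w * v) \<le> Gamma_line_ratio y u powr (1 - w) * Gamma_line_ratio y v powr w"
proof -
  let ?P = "\<lambda>N s. \<Prod>k\<le>N. cmod (Complex (s + real k) y) / (s + real k)"
  have pos: "Gamma_line_ratio y s > 0" if "s > 0" for s
  proof -
    have "Complex s y \<notin> \<int>\<^sub>\<le>\<^sub>0" using that by (auto elim!: nonpos_Ints_cases simp: complex_eq_iff)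
    then show ?thesis using that by (simp add: Gamma_line_ratio_def rGamma_eq_zero_iff)
  qed
  have w: "(1 - w) * u + w * v > 0"
    using assms by (smt (verit, best) mult_nonneg_nonneg mult_pos_pos)
  have "?P N ((1 - w) * u + w * v) \<le> ?P N u powr (1 - w) * ?P N v powr w" for N
  proof -
    have "?P N ((1 - w) * u + w * v)
        = (\<Prod>k\<le>N. cmod (Complex ((1 - w) * (u + k) + w * (v + k)) y) / ((1 - w) * (u + k) + w * (v + k)))"
      by (simp add: algebra_simps)
    also have "\<dots> \<le> (\<Prod>k\<le>N. (cmod (Complex (u + real k) y) / (u + real k)) powr (1 - w)
          * (cmod (Complex (v + real k) y) / (v + real k)) powr w)"
    proof (rule prod_mono, intro conjI)
      fix k
      show "cmod (Complex ((1 - w) * (u + k) + w * (v + k)) y) / ((1 - w) * (u + k) + w * (v + k))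
          \<le> (cmod (Complex (u + real k) y) / (u + real k)) powr (1 - w)
          * (cmod (Complex (v + real k) y) / (v + real k)) powr w"
        by (rule norm_over_re_log_convex) (use assms in auto)
      show "0 \<le> cmod (Complex ((1 - w) * (u + k) + w * (v + k)) y) / ((1 - w) * (u + k) + w * (v + k))"
        using assms by (intro divide_nonneg_nonneg add_nonneg_nonneg mult_nonneg_nonneg) auto
    qed
    also have "\<dots> = ?P N u powr (1 - w) * ?P N v powr w"
      using assms by (simp add: prod.distrib prod_powr_distrib)
    finally show ?thesis .
  qed
  moreover have "(\<lambda>N. ?P N ((1 - w) * u + w * v)) \<longlonglongrightarrow> Gamma_line_ratio y ((1 - w) * u + w * v)"
    by (rule Gamma_line_ratio_limit[OF w])
  moreover have "(\<lambda>N. ?P N u powr (1 - w) * ?P N v powr w)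
      \<longlonglongrightarrow> Gamma_line_ratio y u powr (1 - w) * Gamma_line_ratio y v powr w"
    using pos[of u] pos[of v] assms by (intro tendsto_intros Gamma_line_ratio_limit) auto
  ultimately show ?thesis by (intro LIMSEQ_le) auto
qed

text \<open>
  On the line \<open>Re z = 1/2\<close> reflection is complex conjugation, so the reflection formula determines the
  modulus.
\<close>

lemma norm_rGamma_critical_line:
  "cmod (rGamma (Complex (1/2) y)) = sqrt (cosh (pi * y) / pi)"
proof -
  let ?z = "Complex (1/2) y"
  have c: "1 - ?z = cnj ?z" by (simp add: complex_eq_iff)
  have "rGamma ?z * rGamma (1 - ?z) = of_real ((cmod (rGamma ?z))\<^sup>2)"
    by (simp only: c cnj_rGamma[symmetric] complex_norm_square)
  moreover have "rGamma ?z * rGamma (1 - ?z) = sin (of_real pi * ?z) / of_real pi"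
    by (rule rGamma_reflection_complex)
  moreover have "sin (of_real pi * ?z) = of_real (cosh (pi * y))"
  proof -
    have "of_real pi * ?z = of_real (pi/2) + \<i> * of_real (pi * y)"
      by (simp add: complex_eq_iff)
    then show ?thesis
      by (simp only: sin_add) (simp add: cos_of_real sin_of_real complex_eq_iff Re_cos Im_cos cosh_def)
  qed
  ultimately have "(cmod (rGamma ?z))\<^sup>2 = cosh (pi * y) / pi"
    by (metis of_real_divide of_real_eq_iff)
  then show ?thesis by (metis norm_ge_zero real_sqrt_unique)
qed

lemma norm_Complex_ge: "cmod (Complex s y) \<ge> (\<bar>s\<bar> + \<bar>y\<bar>) / 2"
  using abs_Re_le_cmod[of "Complex s y"] abs_Im_le_cmod[of "Complex s y"] by simp

text \<open>
  Interpolation between \<open>Re z = 1/2\<close>, where the bound is \<open>exp (\<pi> |y| / 2)\<close>, and \<open>Re z = 3/2\<close>, where the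
  recurrence \<open>\<Gamma>(z + 1) = z \<Gamma>(z)\<close> gains one power of \<open>|y|\<close>.  The interpolated exponent of \<open>1 + |y|\<close> is linear
  in \<open>Re z\<close>, as in Stirling's formula.
\<close>

lemma rGamma_bound_strip:
  assumes "0 \<le> w" "w \<le> 1"
  shows "\<exists>C>0. \<forall>y. cmod (rGamma (Complex (1/2 + w) y)) \<le> C * (1 + \<bar>y\<bar>) powr (- w) * exp (pi / 2 * \<bar>y\<bar>)"
proof (intro exI[of _ "2 powr w / Gamma (1/2 + w)"] conjI allI)
  have G: "Gamma (1/2 + w) > 0" using assms by (intro Gamma_real_pos) auto
  show "2 powr w / Gamma (1/2 + w) > 0" using G by simp
  fix y :: real
  let ?g = "Gamma_line_ratio y (1/2)" and ?n = "cmod (Complex (1/2) y)"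
  have n: "?n > 0" by (simp add: complex_eq_iff)
  have g: "?g = sqrt (cosh (pi * y))"
    by (simp add: Gamma_line_ratio_def norm_rGamma_critical_line Gamma_one_half_real real_sqrt_divide)
  have gpos: "?g > 0" unfolding g by (simp add: cosh_real_pos)
  have "rGamma (Complex (1/2) y) = Complex (1/2) y * rGamma (Complex (3/2) y)"
    using rGamma_plus1[of "Complex (1/2) y"] by (simp add: plus_complex.code one_complex.code)
  moreover have "Gamma (3/2 :: real) = 1/2 * Gamma (1/2)"
    using Gamma_plus1[of "1/2 :: real"] nonpos_Ints_nonpos[of "1/2 :: real"] by force
  moreover have strip: "(1 - w) * (1/2) + w * (3/2) = 1/2 + w" by (simp add: field_simps)
  ultimately have "Gamma_line_ratio y (3/2) = ?g * (1 / (2 * ?n))"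
    using n by (simp add: Gamma_line_ratio_def norm_mult field_simps)
  then have "Gamma_line_ratio y (1/2 + w) \<le> ?g powr (1 - w) * (?g * (1 / (2 * ?n))) powr w"
    using Gamma_line_ratio_log_convex[of "1/2" "3/2" w y] assms
    unfolding strip by simp
  also have "\<dots> = ?g * (1 / (2 * ?n)) powr w"
    using gpos n by (subst powr_mult) (auto simp flip: powr_add simp: mult.assoc[symmetric])
  also have "\<dots> \<le> exp (pi / 2 * \<bar>y\<bar>) * (2 / (1 + \<bar>y\<bar>)) powr w"
  proof (intro mult_mono powr_mono2)
    have "cosh (pi * y) \<le> exp (pi * \<bar>y\<bar>)"
      by (cases "y \<ge> 0") (auto simp: cosh_def scaleR_conv_of_real field_simps mult_nonneg_nonpos)
    also have "\<dots> = (exp (pi / 2 * \<bar>y\<bar>))\<^sup>2" by (simp add: power2_eq_square flip: exp_add)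
    finally show "?g \<le> exp (pi / 2 * \<bar>y\<bar>)" unfolding g by (intro real_le_lsqrt) auto
    have "(1 + \<bar>y\<bar>) / 4 \<le> ?n" using norm_Complex_ge[of "1/2" y] by simp
    then show "1 / (2 * ?n) \<le> 2 / (1 + \<bar>y\<bar>)" using n by (simp add: field_simps)
  qed (use assms n in auto)
  also have "\<dots> = 2 powr w * (1 + \<bar>y\<bar>) powr (- w) * exp (pi / 2 * \<bar>y\<bar>)"
    by (simp add: powr_divide powr_minus field_simps)
  finally have "cmod (rGamma (Complex (1/2 + w) y)) * Gamma (1/2 + w)
      \<le> 2 powr w * (1 + \<bar>y\<bar>) powr (- w) * exp (pi / 2 * \<bar>y\<bar>)"
    by (simp only: Gamma_line_ratio_def)
  then show "cmod (rGamma (Complex (1/2 + w) y))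
      \<le> 2 powr w / Gamma (1/2 + w) * (1 + \<bar>y\<bar>) powr (- w) * exp (pi / 2 * \<bar>y\<bar>)"
    using G by (simp add: field_simps)
qed

text \<open>
  Each shift of \<open>Re z\<close> by one multiplies or divides \<open>1 / \<Gamma>\<close> by \<open>|z|\<close>, which is comparable to \<open>1 + |y|\<close>; hence
  the bound spreads from the strip to every vertical line.  Since \<open>1 / \<Gamma>\<close> is entire, lines through
  poles of \<open>\<Gamma>\<close> are included.
\<close>

lemma rGamma_vertical_bound:
  "\<exists>C>0. \<forall>y. cmod (rGamma (Complex s y)) \<le> C * (1 + \<bar>y\<bar>) powr (1/2 - s) * exp (pi / 2 * \<bar>y\<bar>)"
proof -
  define P where "P s \<longleftrightarrow> (\<exists>C>0. \<forall>y. cmod (rGamma (Complex s y))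
      \<le> C * (1 + \<bar>y\<bar>) powr (1/2 - s) * exp (pi / 2 * \<bar>y\<bar>))" for s
  have rec: "cmod (rGamma (Complex s y)) = cmod (Complex s y) * cmod (rGamma (Complex (s + 1) y))" for s y
    using rGamma_plus1[of "Complex s y"] by (simp add: plus_complex.code one_complex.code flip: norm_mult)
  have down: "P s" if Ps: "P (s + 1)" for s
  proof -
    obtain C where "C > 0 \<and> (\<forall>y. cmod (rGamma (Complex (s + 1) y))
        \<le> C * (1 + \<bar>y\<bar>) powr (1/2 - (s + 1)) * exp (pi / 2 * \<bar>y\<bar>))"
      using Ps unfolding P_def ..
    then have C: "C > 0" "\<And>y. cmod (rGamma (Complex (s + 1) y))
        \<le> C * (1 + \<bar>y\<bar>) powr (1/2 - (s + 1)) * exp (pi / 2 * \<bar>y\<bar>)"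
      by auto
    have "cmod (rGamma (Complex s y)) \<le> ((1 + \<bar>s\<bar>) * C) * (1 + \<bar>y\<bar>) powr (1/2 - s) * exp (pi / 2 * \<bar>y\<bar>)" for y
    proof -
      have "cmod (Complex s y) \<le> \<bar>s\<bar> + \<bar>y\<bar>" using cmod_le[of "Complex s y"] by simp
      also have "\<dots> \<le> (1 + \<bar>s\<bar>) * (1 + \<bar>y\<bar>)" by (simp add: algebra_simps)
      finally have "cmod (rGamma (Complex s y)) \<le> ((1 + \<bar>s\<bar>) * (1 + \<bar>y\<bar>)) *
          (C * (1 + \<bar>y\<bar>) powr (1/2 - (s + 1)) * exp (pi / 2 * \<bar>y\<bar>))"
        unfolding rec[of s y] by (intro mult_mono C) auto
      also have "\<dots> = ((1 + \<bar>s\<bar>) * C) * ((1 + \<bar>y\<bar>) * (1 + \<bar>y\<bar>) powr (1/2 - (s + 1))) * exp (pi / 2 * \<bar>y\<bar>)"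
        by (simp only: mult_ac)
      also have "(1 + \<bar>y\<bar>) * (1 + \<bar>y\<bar>) powr (1/2 - (s + 1)) = (1 + \<bar>y\<bar>) powr (1/2 - s)"
        by (subst powr_mult_base) auto
      finally show ?thesis .
    qed
    then show ?thesis unfolding P_def using C(1)
      by (intro exI[of _ "(1 + \<bar>s\<bar>) * C"]) auto
  qed
  have up: "P (s + 1)" if Ps: "P s" and "s > 0" for s
  proof -
    obtain C where "C > 0 \<and> (\<forall>y. cmod (rGamma (Complex s y))
        \<le> C * (1 + \<bar>y\<bar>) powr (1/2 - s) * exp (pi / 2 * \<bar>y\<bar>))"
      using Ps unfolding P_def ..
    then have C: "C > 0" "\<And>y. cmod (rGamma (Complex s y))
        \<le> C * (1 + \<bar>y\<bar>) powr (1/2 - s) * exp (pi / 2 * \<bar>y\<bar>)"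
      by auto
    define m where "m = min s 1 / 2"
    have m: "m > 0" using that by (simp add: m_def)
    have "cmod (rGamma (Complex (s + 1) y)) \<le> (C / m) * (1 + \<bar>y\<bar>) powr (1/2 - (s + 1)) * exp (pi / 2 * \<bar>y\<bar>)" for y
    proof -
      have "min s 1 * \<bar>y\<bar> \<le> 1 * \<bar>y\<bar>" by (intro mult_right_mono) auto
      then have "m * (1 + \<bar>y\<bar>) \<le> (\<bar>s\<bar> + \<bar>y\<bar>) / 2" using that by (simp add: m_def algebra_simps)
      also have "\<dots> \<le> cmod (Complex s y)" by (rule norm_Complex_ge)
      finally have "m * (1 + \<bar>y\<bar>) * cmod (rGamma (Complex (s + 1) y)) \<le> cmod (rGamma (Complex s y))"
        unfolding rec[of s] by (intro mult_right_mono) auto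
      also have "\<dots> \<le> C * (1 + \<bar>y\<bar>) powr (1/2 - s) * exp (pi / 2 * \<bar>y\<bar>)" by (rule C)
      also have "(1 + \<bar>y\<bar>) powr (1/2 - s) = (1 + \<bar>y\<bar>) * (1 + \<bar>y\<bar>) powr (1/2 - (s + 1))"
        by (subst powr_mult_base) auto
      finally have "(1 + \<bar>y\<bar>) * (m * cmod (rGamma (Complex (s + 1) y)))
           \<le> (1 + \<bar>y\<bar>) * (C * (1 + \<bar>y\<bar>) powr (1/2 - (s + 1)) * exp (pi / 2 * \<bar>y\<bar>))"
        by (simp only: mult_ac)
      then have "m * cmod (rGamma (Complex (s + 1) y))
           \<le> C * (1 + \<bar>y\<bar>) powr (1/2 - (s + 1)) * exp (pi / 2 * \<bar>y\<bar>)"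
        by (subst (asm) mult_le_cancel_left_pos) auto
      then show ?thesis using m by (simp add: field_simps)
    qed
    then show ?thesis unfolding P_def using C(1) m
      by (intro exI[of _ "C / m"]) auto
  qed
  define w where "w = frac (s - 1/2)"
  have w: "0 \<le> w" "w \<le> 1" using frac_lt_1[of "s - 1/2"] by (auto simp: w_def)
  have base: "P (1/2 + w)" using rGamma_bound_strip[OF w] by (simp add: P_def)
  have ups: "P (1/2 + w + real n)" for n
  proof (induction n)
    case (Suc n)
    have "P (1/2 + w + real n + 1)" using w by (intro up Suc) auto
    then show ?case by (simp add: add_ac)
  qed (use base in simp)
  have downs: "P (1/2 + w - real n)" for n
  proof (induction n)
    case (Suc n)
    have "P (1/2 + w - real (Suc n))" by (rule down) (use Suc in \<open>simp add: algebra_simps\<close>)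
    then show ?case .
  qed (use base in simp)
  have s: "s = 1/2 + w + of_int \<lfloor>s - 1/2\<rfloor>" by (simp add: w_def frac_def)
  have "P s"
  proof (cases "\<lfloor>s - 1/2\<rfloor> \<ge> 0")
    case True
    then show ?thesis using ups[of "nat \<lfloor>s - 1/2\<rfloor>"] s by simp
  next
    case False
    then show ?thesis using downs[of "nat (- \<lfloor>s - 1/2\<rfloor>)"] s by simp
  qed
  then show ?thesis by (simp add: P_def)
qed

lemma norm_sin_ge:
  assumes "\<bar>Im w\<bar> \<ge> 1"
  shows "cmod (sin w) \<ge> exp \<bar>Im w\<bar> / 4"
proof -
  have *: "exp t - exp (- t) \<ge> exp t / 2" if "t \<ge> 1" for t :: real
  proof -
    have "2 \<le> 1 + t" using that by simp
    also have "\<dots> \<le> exp t" by (rule exp_ge_add_one_self)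
    finally have "2 * 1 \<le> exp t * exp t" using that by (intro mult_mono) auto
    then show ?thesis by (simp add: exp_minus field_simps)
  qed
  have "exp \<bar>Im w\<bar> / 2 \<le> exp \<bar>Im w\<bar> - exp (- \<bar>Im w\<bar>)" using *[OF assms] .
  also have "\<dots> = \<bar>exp (- Im w) - exp (Im w)\<bar>"
    by (cases "Im w \<ge> 0") (auto simp: abs_real_def)
  also have "\<dots> = \<bar>cmod (exp (\<i> * w)) - cmod (exp (- (\<i> * w)))\<bar>" by simp
  also have "\<dots> \<le> cmod (exp (\<i> * w) - exp (- (\<i> * w)))" by (rule norm_triangle_ineq3)
  also have "\<dots> = 2 * cmod (sin w)" by (simp add: sin_exp_eq norm_divide norm_mult)
  finally show ?thesis by simp
qed

text \<open>
  Reflection turns the upper bound for \<open>1 / \<Gamma>(1 - z)\<close> into one for \<open>\<Gamma>(z)\<close>, because \<open>|sin (\<pi> z)|\<close> grows like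
  \<open>exp (\<pi> |y|)\<close>.  Near the real axis the sine may vanish; there compactness suffices.
\<close>

lemma Gamma_vertical_bound:
  assumes "s > 0"
  shows "\<exists>C>0. \<forall>y. cmod (Gamma (Complex s y)) \<le> C * (1 + \<bar>y\<bar>) powr (s - 1/2) * exp (- (pi / 2) * \<bar>y\<bar>)"
proof -
  let ?b = "\<lambda>y. (1 + \<bar>y\<bar>) powr (s - 1/2) * exp (- (pi / 2) * \<bar>y\<bar>)"
  have bpos: "?b y > 0" for y by simp
  have np: "Complex s y \<notin> \<int>\<^sub>\<le>\<^sub>0" for y
    using assms by (auto elim!: nonpos_Ints_cases simp: complex_eq_iff)
  have "continuous_on {-1..1} (\<lambda>y. cmod (Gamma (Complex s y)) / ?b y)"
    unfolding Complex_eq using np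
    by (intro continuous_intros continuous_on_compose2[OF continuous_on_Gamma[of "- \<int>\<^sub>\<le>\<^sub>0"]])
       (auto simp: Complex_eq)
  then have "bounded ((\<lambda>y. cmod (Gamma (Complex s y)) / ?b y) ` {-1..1})"
    by (intro compact_imp_bounded compact_continuous_image) auto
  then obtain M where M: "M > 0" "\<And>y. y \<in> {-1..1} \<Longrightarrow> cmod (Gamma (Complex s y)) / ?b y \<le> M"
    unfolding bounded_pos by (auto simp: abs_le_iff)
  obtain C where C: "C > 0"
      "\<And>y. cmod (rGamma (Complex (1 - s) y)) \<le> C * (1 + \<bar>y\<bar>) powr (1/2 - (1 - s)) * exp (pi / 2 * \<bar>y\<bar>)"
    using rGamma_vertical_bound by blast
  have "cmod (Gamma (Complex s y)) \<le> max M (4 * pi * C) * ?b y" for y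
  proof (cases "\<bar>y\<bar> \<le> 1")
    case True
    then have "y \<in> {-1..1}" by auto
    then have "cmod (Gamma (Complex s y)) / ?b y \<le> M" by (rule M(2))
    then have "cmod (Gamma (Complex s y)) \<le> M * ?b y"
      by (simp only: pos_divide_le_eq[OF bpos])
    also have "\<dots> \<le> max M (4 * pi * C) * ?b y" by (intro mult_right_mono) auto
    finally show ?thesis .
  next
    case False
    let ?z = "Complex s y"
    have "\<bar>y\<bar> * 1 \<le> \<bar>y\<bar> * pi" using pi_gt3 by (intro mult_left_mono) auto
    then have "exp \<bar>Im (of_real pi * ?z)\<bar> / 4 \<le> cmod (sin (of_real pi * ?z))"
      using False by (intro norm_sin_ge) (auto simp: abs_mult mult.commute)
    then have sin: "exp (pi * \<bar>y\<bar>) / 4 \<le> cmod (sin (of_real pi * ?z))" by (simp add: abs_mult)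
    have e: "1 - ?z = Complex (1 - s) (- y)" by (simp add: complex_eq_iff)
    have "rGamma ?z * rGamma (1 - ?z) = sin (of_real pi * ?z) / of_real pi"
      by (rule rGamma_reflection_complex)
    then have "cmod (rGamma ?z) * cmod (rGamma (1 - ?z)) = cmod (sin (of_real pi * ?z)) / pi"
      by (metis norm_mult norm_divide norm_of_real abs_of_pos pi_gt_zero)
    moreover have "cmod (Gamma ?z) * cmod (rGamma ?z) = 1"
      using np[of y] by (simp add: Gamma_def rGamma_eq_zero_iff flip: norm_mult)
    ultimately have "cmod (rGamma (1 - ?z)) = cmod (Gamma ?z) * (cmod (sin (of_real pi * ?z)) / pi)"
      by (metis mult.assoc mult.left_neutral)
    moreover have "cmod (Gamma ?z) * (exp (pi * \<bar>y\<bar>) / 4 / pi)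
        \<le> cmod (Gamma ?z) * (cmod (sin (of_real pi * ?z)) / pi)"
      by (intro mult_left_mono divide_right_mono sin) auto
    ultimately have "cmod (Gamma ?z) * (exp (pi * \<bar>y\<bar>) / 4 / pi) \<le> cmod (rGamma (1 - ?z))"
      by simp
    also have "\<dots> \<le> C * (1 + \<bar>y\<bar>) powr (s - 1/2) * exp (pi / 2 * \<bar>y\<bar>)"
      unfolding e using C(2)[of "- y"] by (simp add: algebra_simps)
    finally have "cmod (Gamma ?z) \<le> C * (1 + \<bar>y\<bar>) powr (s - 1/2) * exp (pi / 2 * \<bar>y\<bar>) / (exp (pi * \<bar>y\<bar>) / 4 / pi)"
      by (subst pos_le_divide_eq) auto
    also have "\<dots> = (4 * pi * C) * (1 + \<bar>y\<bar>) powr (s - 1/2) * (exp (pi / 2 * \<bar>y\<bar>) / exp (pi * \<bar>y\<bar>))"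
      by (simp add: field_simps)
    also have "exp (pi / 2 * \<bar>y\<bar>) / exp (pi * \<bar>y\<bar>) = exp (- (pi / 2) * \<bar>y\<bar>)"
      by (simp flip: exp_diff)
    finally have "cmod (Gamma ?z) \<le> (4 * pi * C) * ?b y" by (simp only: mult.assoc)
    also have "\<dots> \<le> max M (4 * pi * C) * ?b y" by (intro mult_right_mono) auto
    finally show ?thesis .
  qed
  then show ?thesis using M(1) by (intro exI[of _ "max M (4 * pi * C)"]) (auto simp: mult.assoc)
qed

section \<open>The hypergeometric series at argument 1\<close>

lemma not_nonpos_Int_if_Re_pos: "Re z > 0 \<Longrightarrow> z \<notin> \<int>\<^sub>\<le>\<^sub>0"
  by (auto elim!: nonpos_Ints_cases)

lemma pochhammer_shift:
  fixes c :: complex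
  shows "c * pochhammer (c + 1) k = pochhammer c k * (c + of_nat k)"
  by (metis pochhammer_rec pochhammer_rec' mult.commute)

lemma norm_pochhammer_mono:
  assumes "Re c > 0"
  shows "cmod (pochhammer c k) \<le> cmod (pochhammer (c + of_nat n) k)"
  unfolding pochhammer_prod prod_norm[symmetric]
proof (intro prod_mono conjI)
  fix i
  have "\<bar>Re (c + of_nat i)\<bar> \<le> \<bar>Re (c + of_nat n + of_nat i)\<bar>" using assms by simp
  then show "cmod (c + of_nat i) \<le> cmod (c + of_nat n + of_nat i)"
    unfolding cmod_def by (intro real_sqrt_le_mono add_mono) (auto simp: abs_le_square_iff)
qed simp

text \<open>
  A reindexed form of Euler's limit.  Dividing by \<open>n! (n + 1)\<close> to a real power, instead of the usual
  \<open>n! n\<^sup>z\<close>, gives a sequence that is defined for all \<open>n \<ge> 0\<close>; its convergence then yields bounds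
  that are uniform in \<open>n\<close>.
\<close>

lemma pochhammer_growth_limit:
  fixes z :: complex
  shows "(\<lambda>n. cmod (pochhammer z n) / (fact n * real (n + 1) powr (Re z - 1))) \<longlonglongrightarrow> cmod (rGamma z)"
proof (rule LIMSEQ_imp_Suc)
  have "(\<lambda>n. cmod (rGamma_series z n) * (real n powr Re z / (real (n + 1) * real (n + 2) powr (Re z - 1))))
      \<longlonglongrightarrow> cmod (rGamma z) * 1"
    by (intro tendsto_intros) real_asymp
  then have lim: "(\<lambda>n. cmod (rGamma_series z n) * (real n powr Re z / (real (n + 1) * real (n + 2) powr (Re z - 1))))
      \<longlonglongrightarrow> cmod (rGamma z)" by simp
  have ev: "\<forall>\<^sub>F n in sequentially.
      cmod (rGamma_series z n) * (real n powr Re z / (real (n + 1) * real (n + 2) powr (Re z - 1)))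
      = cmod (pochhammer z (Suc n)) / (fact (Suc n) * real (Suc n + 1) powr (Re z - 1))"
    using eventually_gt_at_top[of 0]
  proof eventually_elim
    case (elim n)
    then have "real n powr Re z = exp (Re z * ln (real n))" by (simp add: powr_def)
    then show ?case using elim
      by (simp add: rGamma_series_def norm_divide norm_mult add_ac)
  qed
  show "(\<lambda>n. cmod (pochhammer z (Suc n)) / (fact (Suc n) * real (Suc n + 1) powr (Re z - 1)))
      \<longlonglongrightarrow> cmod (rGamma z)"
    by (rule Lim_transform_eventually[OF lim ev])
qed

lemma pochhammer_upper_bound:
  fixes z :: complex
  obtains C where "C > 0" "\<And>n. cmod (pochhammer z n) \<le> C * fact n * real (n + 1) powr (Re z - 1)"
proof -
  have "Bseq (\<lambda>n. cmod (pochhammer z n) / (fact n * real (n + 1) powr (Re z - 1)))"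
    by (intro convergent_imp_Bseq convergentI[OF pochhammer_growth_limit])
  then obtain C where C: "C > 0"
    "\<And>n. norm (cmod (pochhammer z n) / (fact n * real (n + 1) powr (Re z - 1))) \<le> C"
    by (auto elim: BseqE)
  have "cmod (pochhammer z n) \<le> C * fact n * real (n + 1) powr (Re z - 1)" for n
    using C(2)[of n] by (simp add: divide_simps mult_ac)
  then show thesis using that C(1) by blast
qed

lemma pochhammer_lower_bound:
  fixes z :: complex
  assumes "z \<notin> \<int>\<^sub>\<le>\<^sub>0"
  obtains C where "C > 0" "\<And>n. fact n * real (n + 1) powr (Re z - 1) \<le> C * cmod (pochhammer z n)"
proof -
  have "rGamma z \<noteq> 0" using assms by (simp add: rGamma_eq_zero_iff)
  then have "(\<lambda>n. inverse (cmod (pochhammer z n) / (fact n * real (n + 1) powr (Re z - 1))))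
      \<longlonglongrightarrow> inverse (cmod (rGamma z))"
    by (intro tendsto_inverse pochhammer_growth_limit) auto
  then have "Bseq (\<lambda>n. inverse (cmod (pochhammer z n) / (fact n * real (n + 1) powr (Re z - 1))))"
    by (intro convergent_imp_Bseq convergentI)
  then obtain C where C: "C > 0"
    "\<And>n. norm (inverse (cmod (pochhammer z n) / (fact n * real (n + 1) powr (Re z - 1)))) \<le> C"
    by (auto elim: BseqE)
  have "fact n * real (n + 1) powr (Re z - 1) \<le> C * cmod (pochhammer z n)" for n
  proof -
    have "pochhammer z n \<noteq> 0"
      using assms by (auto simp: pochhammer_eq_0_iff)
    then show ?thesis using C(2)[of n] by (simp add: divide_simps mult_ac)
  qed
  then show thesis using that C(1) by blast
qed

text \<open>
  The Taylor coefficients of the Gauss hypergeometric function.  Taking \<open>b = 1\<close> cancels \<open>k!\<close>, so that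
  quotients of rising factorials, and with \<open>b = c = 1\<close> the binomial coefficients up to sign, are special cases.
\<close>

definition hyp_coeff :: "complex \<Rightarrow> complex \<Rightarrow> complex \<Rightarrow> nat \<Rightarrow> complex" where
  "hyp_coeff a b c k = pochhammer a k * pochhammer b k / (pochhammer c k * fact k)"

lemma hyp_coeff_bound:
  assumes "c \<notin> \<int>\<^sub>\<le>\<^sub>0"
  obtains C where "C > 0" "\<And>k. cmod (hyp_coeff a b c k) \<le> C * real (k + 1) powr (Re (a + b - c) - 1)"
proof -
  obtain A where A: "A > 0" "\<And>n. cmod (pochhammer a n) \<le> A * fact n * real (n + 1) powr (Re a - 1)"
    using pochhammer_upper_bound[of a] by metis
  obtain B where B: "B > 0" "\<And>n. cmod (pochhammer b n) \<le> B * fact n * real (n + 1) powr (Re b - 1)"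
    using pochhammer_upper_bound[of b] by metis
  obtain D where D: "D > 0" "\<And>n. fact n * real (n + 1) powr (Re c - 1) \<le> D * cmod (pochhammer c n)"
    using pochhammer_lower_bound[OF assms] by metis
  have "cmod (hyp_coeff a b c k) \<le> (A * B * D) * real (k + 1) powr (Re (a + b - c) - 1)" for k
  proof -
    let ?t = "real (k + 1)"
    have pos: "fact k * ?t powr (Re c - 1) / D > 0" using D(1) by simp
    have "cmod (hyp_coeff a b c k)
        = cmod (pochhammer a k) * cmod (pochhammer b k) / (cmod (pochhammer c k) * fact k)"
      by (simp add: hyp_coeff_def norm_mult norm_divide)
    also have "\<dots> \<le> (A * fact k * ?t powr (Re a - 1)) * (B * fact k * ?t powr (Re b - 1))
        / (fact k * ?t powr (Re c - 1) / D * fact k)"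
      using D(1) D(2)[of k] A(1) B(1) pos
      by (intro frac_le mult_mono A B) (auto simp: divide_simps mult_ac)
    also have "\<dots> = (A * B * D) * (?t powr (Re a - 1) * ?t powr (Re b - 1) / ?t powr (Re c - 1))"
      using D(1) by (simp add: divide_simps)
    also have "?t powr (Re a - 1) * ?t powr (Re b - 1) / ?t powr (Re c - 1) = ?t powr (Re (a + b - c) - 1)"
      by (simp flip: powr_add powr_diff add: algebra_simps)
    finally show ?thesis .
  qed
  then show thesis using that[of "A * B * D"] A(1) B(1) D(1) by auto
qed

lemma summable_Suc_powr: "p < -1 \<Longrightarrow> summable (\<lambda>k. real (k + 1) powr p)"
  using summable_real_powr_iff[of p] summable_Suc_iff[of "\<lambda>k. real k powr p"] by simp

lemma summable_norm_hyp_coeff: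
  assumes "c \<notin> \<int>\<^sub>\<le>\<^sub>0" "Re (c - a - b) > 0"
  shows "summable (\<lambda>k. cmod (hyp_coeff a b c k))"
proof -
  obtain C where C: "C > 0" "\<And>k. cmod (hyp_coeff a b c k) \<le> C * real (k + 1) powr (Re (a + b - c) - 1)"
    using hyp_coeff_bound[OF assms(1)] by metis
  show ?thesis
    by (rule summable_comparison_test'[OF summable_mult[OF summable_Suc_powr], where N = 0])
       (use C assms in auto)
qed

text \<open>
  The termwise form of Gauss's contiguous relation between the parameters \<open>c\<close> and \<open>c + 1\<close> at argument 1.
  The right-hand side telescopes when summed over \<open>k\<close>.
\<close>

lemma hyp_coeff_contiguous:
  assumes "c \<notin> \<int>\<^sub>\<le>\<^sub>0"
  shows "c * (c - a - b) * hyp_coeff a b c k - (c - a) * (c - b) * hyp_coeff a b (c + 1) k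
       = c * (of_nat k * hyp_coeff a b c k - of_nat (Suc k) * hyp_coeff a b c (Suc k))"
proof -
  have nz: "c + of_nat j \<noteq> 0" for j
    using assms by (metis add_eq_0_iff2 minus_of_nat_in_nonpos_Ints)
  have p: "pochhammer c k \<noteq> 0"
    using assms by (auto simp: pochhammer_eq_0_iff)
  have c0: "c \<noteq> 0" using nz[of 0] by simp
  have "pochhammer (c + 1) k = pochhammer c k * (c + of_nat k) / c"
    using c0 pochhammer_shift[of c k] by (simp add: field_simps)
  then have 1: "hyp_coeff a b (c + 1) k = hyp_coeff a b c k * (c / (c + of_nat k))"
    using c0 by (simp add: hyp_coeff_def)
  have 2: "of_nat (Suc k) * hyp_coeff a b c (Suc k)
      = hyp_coeff a b c k * ((a + of_nat k) * (b + of_nat k) / (c + of_nat k))"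
    using nz[of k] p by (simp add: hyp_coeff_def pochhammer_Suc divide_simps del: of_nat_Suc)
  show ?thesis unfolding 1 2 using nz[of k]
    by (simp add: divide_simps) algebra
qed

text \<open>
  The boundary term of the telescoping sum.  The coefficients are of order at most \<open>k\<close> to the power
  \<open>Re (a + b - c) - 1\<close>, so \<open>Re (c - a - b) > 0\<close> leaves room for one further factor \<open>k\<close>.
\<close>

lemma mult_hyp_coeff_tendsto_0:
  assumes "c \<notin> \<int>\<^sub>\<le>\<^sub>0" "Re (c - a - b) > 0"
  shows "(\<lambda>k. of_nat k * hyp_coeff a b c k) \<longlonglongrightarrow> 0"
proof -
  obtain C where C: "C > 0" "\<And>k. cmod (hyp_coeff a b c k) \<le> C * real (k + 1) powr (Re (a + b - c) - 1)"
    using hyp_coeff_bound[OF assms(1)] by metis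
  have "Re (a + b - c) < 0" using assms(2) by simp
  then have lim: "(\<lambda>k. real k * (C * real (k + 1) powr (Re (a + b - c) - 1))) \<longlonglongrightarrow> 0"
    by real_asymp
  have bound: "cmod (of_nat k * hyp_coeff a b c k) \<le> real k * (C * real (k + 1) powr (Re (a + b - c) - 1))" for k
    unfolding norm_mult norm_of_nat by (intro mult_left_mono C) auto
  show ?thesis
    by (rule Lim_null_comparison[OF always_eventually[OF allI[OF bound]] lim])
qed

lemma hyp_sum_contiguous:
  assumes "c \<notin> \<int>\<^sub>\<le>\<^sub>0" "Re (c - a - b) > 0"
  shows "c * (c - a - b) * (\<Sum>k. hyp_coeff a b c k) = (c - a) * (c - b) * (\<Sum>k. hyp_coeff a b (c + 1) k)"
proof -
  have c1: "c + 1 \<notin> \<int>\<^sub>\<le>\<^sub>0" using assms(1) plus_one_in_nonpos_Ints_imp by blast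
  have s0: "summable (hyp_coeff a b c)"
    using summable_norm_hyp_coeff[OF assms] by (rule summable_norm_cancel)
  have s1: "summable (hyp_coeff a b (c + 1))"
    by (rule summable_norm_cancel, rule summable_norm_hyp_coeff[OF c1]) (use assms(2) in simp)
  have "(\<lambda>k. c * (c - a - b) * hyp_coeff a b c k - (c - a) * (c - b) * hyp_coeff a b (c + 1) k)
      sums (c * (c - a - b) * (\<Sum>k. hyp_coeff a b c k) - (c - a) * (c - b) * (\<Sum>k. hyp_coeff a b (c + 1) k))"
    by (intro sums_diff sums_mult summable_sums s0 s1)
  moreover have "(\<lambda>k. c * (of_nat k * hyp_coeff a b c k - of_nat (Suc k) * hyp_coeff a b c (Suc k)))
      sums (c * (of_nat 0 * hyp_coeff a b c 0 - 0))"
    by (intro sums_mult telescope_sums' mult_hyp_coeff_tendsto_0 assms)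
  ultimately have "c * (c - a - b) * (\<Sum>k. hyp_coeff a b c k) - (c - a) * (c - b) * (\<Sum>k. hyp_coeff a b (c + 1) k)
      = c * (of_nat 0 * hyp_coeff a b c 0 - 0)"
    unfolding hyp_coeff_contiguous[OF assms(1)] by (rule sums_unique2)
  then show ?thesis by simp
qed

text \<open>
  Every term but the first contains a factor \<open>1 / (c + n)\<close>, and the terms for \<open>n = 0\<close> dominate all later
  ones because \<open>Re c > 0\<close>; Tannery's theorem applies.
\<close>

lemma hyp_sum_shift_tendsto_1:
  assumes "Re c > 0" "Re (c - a - b) > 0"
  shows "(\<lambda>n. \<Sum>k. hyp_coeff a b (c + of_nat n) k) \<longlonglongrightarrow> 1"
proof -
  have c: "c \<notin> \<int>\<^sub>\<le>\<^sub>0" using assms(1) by (rule not_nonpos_Int_if_Re_pos)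
  have p0: "pochhammer c k \<noteq> 0" for k using c by (auto simp: pochhammer_eq_0_iff)
  have bound: "cmod (hyp_coeff a b (c + of_nat n) k) \<le> cmod (hyp_coeff a b c k)" for k n
    unfolding hyp_coeff_def norm_divide norm_mult using p0[of k]
    by (intro divide_left_mono mult_right_mono norm_pochhammer_mono[OF assms(1)] mult_pos_pos)
       (use norm_pochhammer_mono[OF assms(1), of k n] in auto)
  have lim: "(\<lambda>n. hyp_coeff a b (c + of_nat n) k) \<longlonglongrightarrow> (if k = 0 then 1 else 0)" for k
  proof (cases k)
    case 0
    then show ?thesis by (simp add: hyp_coeff_def)
  next
    case (Suc j)
    define M where "M = cmod (pochhammer a k * pochhammer b k) / cmod (pochhammer (c + 1) j * fact k)"
    have c1: "pochhammer (c + 1) j \<noteq> 0"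
      using p0[of k] Suc by (simp add: pochhammer_rec)
    have bd: "cmod (hyp_coeff a b (c + of_nat n) k) \<le> M / (Re c + real n)" for n
    proof -
      have *: "cmod (pochhammer (c + 1) j) \<le> cmod (pochhammer (c + of_nat n + 1) j)"
        using norm_pochhammer_mono[of "c + 1" j n] assms(1) by (simp add: add_ac)
      have **: "Re c + real n \<le> cmod (c + of_nat n)"
        using complex_Re_le_cmod[of "c + of_nat n"] by simp
      have "cmod (hyp_coeff a b (c + of_nat n) k) = cmod (pochhammer a k * pochhammer b k) /
          (cmod (c + of_nat n) * cmod (pochhammer (c + of_nat n + 1) j) * fact k)"
        by (simp add: hyp_coeff_def Suc pochhammer_rec norm_mult norm_divide del: fact_Suc)
      also have "\<dots> \<le> cmod (pochhammer a k * pochhammer b k) /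
          ((Re c + real n) * cmod (pochhammer (c + 1) j) * fact k)"
        using * ** assms(1) c1 by (intro divide_left_mono mult_right_mono mult_mono mult_pos_pos) auto
      also have "\<dots> = M / (Re c + real n)"
        using c1 assms(1) by (simp add: M_def norm_mult divide_simps)
      finally show ?thesis .
    qed
    have "(\<lambda>n. M / (Re c + real n)) \<longlonglongrightarrow> 0" by real_asymp
    then have "(\<lambda>n. hyp_coeff a b (c + of_nat n) k) \<longlonglongrightarrow> 0"
      by (rule Lim_null_comparison[rotated]) (use bd in auto)
    then show ?thesis by (simp add: Suc)
  qed
  have ev: "\<forall>\<^sub>F (k, n) in sequentially \<times>\<^sub>F sequentially.
      cmod (hyp_coeff a b (c + of_nat n) k) \<le> cmod (hyp_coeff a b c k)"
    by (intro always_eventually) (auto intro: bound)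
  have "(\<lambda>n. \<Sum>k. hyp_coeff a b (c + of_nat n) k) \<longlonglongrightarrow> (\<Sum>k. if k = 0 then 1 else 0)"
    using tannerys_theorem[where a = "\<lambda>k n. hyp_coeff a b (c + of_nat n) k",
        OF lim ev summable_norm_hyp_coeff[OF c assms(2)]] by simp
  also have "(\<Sum>k::nat. if k = 0 then 1 else 0) = (1::complex)"
    using sums_single[of 0 "\<lambda>_. 1::complex"] by (simp add: sums_iff)
  finally show ?thesis .
qed

text \<open>
  Gauss's evaluation of the hypergeometric series at argument 1.  Iterating the contiguous relation
  \<open>n\<close> times expresses the sum for \<open>c\<close> by the sum for \<open>c + n\<close>, which tends to 1, times a quotient of rising
  factorials.  In that quotient the factors \<open>n! n\<^sup>z\<close> of Euler's limit cancel, since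
  \<open>c + (c - a - b) = (c - a) + (c - b)\<close>, so it converges to the quotient of Gamma values.
\<close>

theorem Gauss_summation:
  assumes "Re c > 0" "Re (c - a - b) > 0"
  shows "(\<Sum>k. hyp_coeff a b c k) = Gamma c * Gamma (c - a - b) * rGamma (c - a) * rGamma (c - b)"
proof -
  define d where "d = c - a - b"
  note np = not_nonpos_Int_if_Re_pos
  let ?F = "\<lambda>n. \<Sum>k. hyp_coeff a b (c + of_nat n) k"
  have iter: "pochhammer c n * pochhammer d n * ?F 0 = pochhammer (c - a) n * pochhammer (c - b) n * ?F n" for n
  proof (induction n)
    case (Suc n)
    have "(c + of_nat n) * (d + of_nat n) * ?F n = (c - a + of_nat n) * (c - b + of_nat n) * ?F (Suc n)"
      using hyp_sum_contiguous[of "c + of_nat n" a b] assms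
      by (simp add: np d_def algebra_simps)
    then have "pochhammer c n * pochhammer d n * ?F 0 * ((c + of_nat n) * (d + of_nat n))
        = pochhammer (c - a) n * pochhammer (c - b) n * ((c - a + of_nat n) * (c - b + of_nat n) * ?F (Suc n))"
      unfolding Suc by (simp only: mult_ac)
    then show ?case by (simp only: pochhammer_Suc mult_ac)
  qed simp
  have ev: "\<forall>\<^sub>F n in sequentially. rGamma_series c n * rGamma_series d n * ?F 0
      = rGamma_series (c - a) n * rGamma_series (c - b) n * ?F (Suc n)"
  proof (intro always_eventually allI)
    fix n
    let ?e = "\<lambda>z. fact n * exp (z * of_real (ln (real n)))"
    have e: "?e c * ?e d = ?e (c - a) * ?e (c - b)"
      by (simp add: d_def algebra_simps flip: exp_add)
    have "rGamma_series c n * rGamma_series d n * ?F 0 = pochhammer c (n + 1) * pochhammer d (n + 1) * ?F 0 / (?e c * ?e d)"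
      by (simp add: rGamma_series_def)
    also have "\<dots> = rGamma_series (c - a) n * rGamma_series (c - b) n * ?F (Suc n)"
      unfolding iter e by (simp add: rGamma_series_def)
    finally show "rGamma_series c n * rGamma_series d n * ?F 0
      = rGamma_series (c - a) n * rGamma_series (c - b) n * ?F (Suc n)" .
  qed
  have lim1: "(\<lambda>n. rGamma_series c n * rGamma_series d n * ?F 0) \<longlonglongrightarrow> rGamma c * rGamma d * ?F 0"
    by (intro tendsto_intros)
  have lim2: "(\<lambda>n. rGamma_series (c - a) n * rGamma_series (c - b) n * ?F (Suc n))
      \<longlonglongrightarrow> rGamma (c - a) * rGamma (c - b) * 1"
    by (intro tendsto_mult rGamma_series_LIMSEQ LIMSEQ_Suc[OF hyp_sum_shift_tendsto_1] assms)
  have "rGamma c * rGamma d * ?F 0 = rGamma (c - a) * rGamma (c - b) * 1"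
    by (rule LIMSEQ_unique[OF Lim_transform_eventually[OF lim1 ev] lim2])
  moreover have "Gamma c * rGamma c = 1" "Gamma d * rGamma d = 1"
    using np[of c] np[of d] assms by (simp_all add: Gamma_def rGamma_eq_zero_iff d_def)
  ultimately have "?F 0 = Gamma c * Gamma d * (rGamma (c - a) * rGamma (c - b))"
    by algebra
  then show ?thesis by (simp add: d_def mult.assoc)
qed

section \<open>Beta and Euler integrals, and the Saigo operator on powers\<close>

lemma borel_measurable_of_real_powr [measurable]:
  fixes f :: "'a \<Rightarrow> real" and z :: complex
  assumes [measurable]: "f \<in> borel_measurable M"
  shows "(\<lambda>x. of_real (f x) powr z) \<in> borel_measurable M"
proof -
  have "(\<lambda>x. of_real (f x) powr z) = (\<lambda>x. if f x = 0 then 0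
      else exp (z * (of_real (ln \<bar>f x\<bar>) + (if f x < 0 then of_real pi * \<i> else 0))))"
    by (auto simp: fun_eq_iff powr_def Ln_of_real')
  then show ?thesis by simp
qed

text \<open>
  The change-of-variables and fundamental theorems speak about the gauge integral and Lebesgue
  measure, Fubini's theorem about Borel measure; for Borel functions the two agree.
\<close>

lemma set_lborel_iff_lebesgue:
  fixes f :: "real \<Rightarrow> complex"
  assumes m: "(\<lambda>u. indicator S u *\<^sub>R f u) \<in> borel_measurable borel"
  shows "set_integrable lborel S f \<longleftrightarrow> f absolutely_integrable_on S"
    and "f absolutely_integrable_on S \<Longrightarrow> (LINT u:S|lborel. f u) = integral S f"
proof -
  have m': "(\<lambda>u. indicator S u *\<^sub>R f u) \<in> borel_measurable lborel" using m by simp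
  show "set_integrable lborel S f \<longleftrightarrow> f absolutely_integrable_on S"
    using integrable_completion[OF m'] by (simp add: set_integrable_def)
  assume *: "f absolutely_integrable_on S"
  have "(LINT u:S|lborel. f u) = (LINT u:S|lebesgue. f u)"
    by (simp add: set_lebesgue_integral_def integral_completion[OF m'])
  also have "\<dots> = integral S f"
    by (rule set_lebesgue_integral_eq_integral(2)[OF *])
  finally show "(LINT u:S|lborel. f u) = integral S f" .
qed

text \<open>
  Termwise integration of a power series against a weight on the unit interval.  Absolute convergence
  of the integrated series takes the place of uniform convergence, which fails near 1 and for weights
  that are singular at the endpoints.
\<close>

lemma power_series_integral_Ioo:
  fixes g :: "real \<Rightarrow> complex" and h :: "nat \<Rightarrow> complex"
  assumes int: "\<And>k. set_integrable lborel {0<..<1} (\<lambda>u. g u * of_real u ^ k)"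
    and sm: "\<And>u. 0 < u \<Longrightarrow> u < 1 \<Longrightarrow> summable (\<lambda>k. cmod (h k) * u ^ k)"
    and si: "summable (\<lambda>k. cmod (h k) * (LINT u:{0<..<1}|lborel. cmod (g u) * u ^ k))"
  shows "set_integrable lborel {0<..<1} (\<lambda>u. g u * (\<Sum>k. h k * of_real u ^ k))" (is ?A)
    and "(\<lambda>k. h k * (LINT u:{0<..<1}|lborel. g u * of_real u ^ k))
           sums (LINT u:{0<..<1}|lborel. g u * (\<Sum>k. h k * of_real u ^ k))" (is ?B)
proof -
  define f where "f k u = indicator {0<..<1} u *\<^sub>R (h k * (g u * of_real u ^ k))" for k and u :: real
  have i: "integrable lborel (f k)" for k
    using set_integrable_mult_right[OF int[of k], of "h k"]
    unfolding f_def set_integrable_def by (simp add: mult_ac)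
  have n: "norm (f k u) = indicator {0<..<1} u * (cmod (h k) * (cmod (g u) * u ^ k))" for k u
    by (auto simp: f_def norm_mult norm_power split: split_indicator)
  have s1: "AE u in lborel. summable (\<lambda>k. norm (f k u))"
  proof (intro always_eventually allI)
    fix u :: real
    show "summable (\<lambda>k. norm (f k u))"
    proof (cases "u \<in> {0<..<1}")
      case True
      then have "summable (\<lambda>k. cmod (g u) * (cmod (h k) * u ^ k))"
        by (intro summable_mult sm) auto
      with True show ?thesis by (simp add: n mult_ac)
    qed (simp add: n)
  qed
  have "(\<integral>u. norm (f k u) \<partial>lborel) = cmod (h k) * (LINT u:{0<..<1}|lborel. cmod (g u) * u ^ k)" for k
    unfolding n set_lebesgue_integral_def
    by (subst integral_mult_right_zero[symmetric], intro Bochner_Integration.integral_cong) simp_all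
  then have s2: "summable (\<lambda>k. \<integral>u. norm (f k u) \<partial>lborel)" using si by simp
  have e: "(\<Sum>k. f k u) = indicator {0<..<1} u *\<^sub>R (g u * (\<Sum>k. h k * of_real u ^ k))" for u
  proof (cases "u \<in> {0<..<1}")
    case True
    then have "summable (\<lambda>k. norm (h k * of_real u ^ k))"
      using sm[of u] by (simp add: norm_mult norm_power)
    then have "summable (\<lambda>k. h k * of_real u ^ k)" by (rule summable_norm_cancel)
    from suminf_mult[OF this, of "g u"] True show ?thesis
      by (simp add: f_def mult_ac)
  qed (simp add: f_def)
  show ?A using integrable_suminf[OF i s1 s2] by (simp add: set_integrable_def e)
  have "(\<integral>u. f k u \<partial>lborel) = h k * (LINT u:{0<..<1}|lborel. g u * of_real u ^ k)" for k
    by (simp add: f_def set_lebesgue_integral_def flip: mult_scaleR_right)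
  then show ?B using sums_integral[OF i s1 s2] by (simp add: set_lebesgue_integral_def e)
qed

lemma powr_integral_Ioo:
  assumes "Re a > 0"
  shows "set_integrable lborel {0<..<1} (\<lambda>u. of_real u powr (a - 1))"
    and "(LINT u:{0<..<1}|lborel. of_real u powr (a - 1)) = 1 / a"
proof -
  have a: "a \<noteq> 0" using assms by auto
  have "((\<lambda>u. of_real u powr (a - 1)) has_integral (of_real 1 powr a / a - of_real 0 powr a / a)) {0..1}"
  proof (rule fundamental_theorem_of_calculus_interior)
    show "continuous_on {0..1} (\<lambda>u. complex_of_real u powr a / a)"
      using assms a by (intro continuous_intros) auto
    fix u :: real assume "u \<in> {0<..<1}"
    then have "((\<lambda>w. w powr a / a) has_field_derivative of_real u powr (a - 1)) (at (of_real u))"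
      using a by (auto intro!: derivative_eq_intros simp: powr_diff)
    then show "((\<lambda>u. complex_of_real u powr a / a) has_vector_derivative of_real u powr (a - 1)) (at u)"
      by (rule has_vector_derivative_real_field)
  qed simp
  then have 1: "((\<lambda>u. of_real u powr (a - 1)) has_integral 1 / a) {0<..<1}"
    by (simp add: has_integral_Icc_iff_Ioo)
  have "(\<lambda>u. u powr (Re a - 1)) integrable_on {0..1}"
    using has_integral_powr_from_0[of "Re a - 1" 1] assms by auto
  then have "(\<lambda>u. u powr (Re a - 1)) integrable_on {0<..<1}"
    by (simp add: integrable_on_Icc_iff_Ioo)
  then have "(\<lambda>u. cmod (of_real u powr (a - 1))) integrable_on {0<..<1}"
    by (rule integrable_eq) (simp add: norm_powr_real_powr)
  then have 2: "(\<lambda>u. complex_of_real u powr (a - 1)) absolutely_integrable_on {0<..<1}"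
    using 1 by (intro absolutely_integrable_onI) auto
  have m: "(\<lambda>u. indicator {0<..<1} u *\<^sub>R complex_of_real u powr (a - 1)) \<in> borel_measurable borel"
    by measurable
  show "set_integrable lborel {0<..<1} (\<lambda>u. of_real u powr (a - 1))"
    using set_lborel_iff_lebesgue(1)[OF m] 2 by simp
  show "(LINT u:{0<..<1}|lborel. of_real u powr (a - 1)) = 1 / a"
    using set_lborel_iff_lebesgue(2)[OF m 2] 1 by (simp add: integral_unique)
qed

lemma powr_integral_Ioo_real:
  fixes r :: real
  assumes "r > 0"
  shows "(LINT u:{0<..<1}|lborel. u powr (r - 1)) = 1 / r"
proof -
  have "complex_of_real (LINT u:{0<..<1}|lborel. u powr (r - 1))
      = (LINT u:{0<..<1}|lborel. complex_of_real (u powr (r - 1)))"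
    by (simp add: set_lebesgue_integral_def scaleR_conv_of_real flip: integral_complex_of_real)
  also have "\<dots> = (LINT u:{0<..<1}|lborel. of_real u powr (of_real r - 1))"
    by (rule set_lebesgue_integral_cong) (auto simp: powr_of_real[symmetric])
  also have "\<dots> = of_real (1 / r)" using powr_integral_Ioo(2)[of "of_real r"] assms by simp
  finally show ?thesis by (simp only: of_real_eq_iff)
qed

lemma summable_hyp_coeff_power:
  assumes "c \<notin> \<int>\<^sub>\<le>\<^sub>0" "0 < u" "u < 1"
  shows "summable (\<lambda>k. cmod (hyp_coeff a b c k) * u ^ k)"
proof -
  obtain C where C: "C > 0" "\<And>k. cmod (hyp_coeff a b c k) \<le> C * real (k + 1) powr (Re (a + b - c) - 1)"
    using hyp_coeff_bound[OF assms(1)] by metis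
  define p where "p = Re (a + b - c) - 1"
  have O: "(\<lambda>k. real (k + 1) powr p * u ^ k) \<in> O(\<lambda>k. real k powr (-2))"
    using assms(2,3) by real_asymp
  have "summable (\<lambda>k. norm (real k powr (-2)))" by (simp add: summable_real_powr_iff)
  then have "summable (\<lambda>k. real (k + 1) powr p * u ^ k)"
    by (rule summable_comparison_test_bigo[OF _ O])
  then have "summable (\<lambda>k. C * (real (k + 1) powr p * u ^ k))"
    by (rule summable_mult)
  then show ?thesis
    by (rule summable_comparison_test'[where N = 0])
       (use C assms in \<open>auto simp: mult.assoc[symmetric] p_def intro!: mult_right_mono\<close>)
qed

text \<open>
  Integrating \<open>u\<close> to the power \<open>a + k - 1\<close> produces \<open>1 / (a + k)\<close>.  This identity says that the factor turns
  binomial coefficients into hypergeometric ones.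
\<close>

lemma hyp_coeff_divide_shift:
  assumes "Re a > 0"
  shows "hyp_coeff b 1 1 k / (a + of_nat k) = 1 / a * hyp_coeff b a (a + 1) k"
proof -
  have "a \<noteq> 0" "a + of_nat k \<noteq> 0" using assms by (auto simp: complex_eq_iff)
  moreover have "pochhammer a k \<noteq> 0"
    using not_nonpos_Int_if_Re_pos[OF assms] by (auto simp: pochhammer_eq_0_iff)
  moreover have "pochhammer (a + 1) k = pochhammer a k * (a + of_nat k) / a"
    using \<open>a \<noteq> 0\<close> pochhammer_shift[of a k] by (simp add: field_simps)
  ultimately show ?thesis
    by (simp add: hyp_coeff_def pochhammer_fact[symmetric])
qed

lemma powr_mult_power_of_real:
  assumes "0 < u"
  shows "of_real u powr z * of_real u ^ k = (of_real u :: complex) powr (z + of_nat k)"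
  using assms by (simp add: powr_add powr_nat)

lemma binomial_series_hyp_coeff:
  assumes "0 < u" "u < 1"
  shows "(\<Sum>k. hyp_coeff b 1 1 k * of_real u ^ k) = of_real (1 - u) powr (- b)"
proof -
  have "(\<lambda>k. (- b gchoose k) * (of_real (- u)) ^ k) sums (1 + of_real (- u)) powr (- b)"
    by (rule gen_binomial_complex) (use assms in simp)
  also have "(\<lambda>k. (- b gchoose k) * (of_real (- u)) ^ k) = (\<lambda>k. hyp_coeff b 1 1 k * of_real u ^ k)"
  proof
    fix k
    have "(- b gchoose k) * (of_real (- u)) ^ k
        = ((-1) ^ k * (-1) ^ k) * (pochhammer b k / fact k * of_real u ^ k)"
      by (simp add: gbinomial_pochhammer power_minus[of "of_real u"])
    also have "(-1) ^ k * (-1) ^ k = (1 :: complex)" by (simp flip: power_mult_distrib)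
    finally show "(- b gchoose k) * (of_real (- u)) ^ k = hyp_coeff b 1 1 k * of_real u ^ k"
      by (simp add: hyp_coeff_def pochhammer_fact[symmetric])
  qed
  finally show ?thesis by (simp add: sums_iff)
qed

text \<open>
  Euler's Beta integral for complex parameters is itself an instance of Gauss's theorem: expand
  \<open>(1 - u)\<close> to the power \<open>b - 1\<close> into the binomial series and integrate term by term to get
  \<open>(1 / a) F(1 - b, a; a + 1; 1)\<close>.
\<close>

theorem Beta_integral_complex:
  assumes "Re a > 0" "Re b > 0"
  shows "set_integrable lborel {0<..<1} (\<lambda>u. of_real u powr (a - 1) * of_real (1 - u) powr (b - 1))"
    and "(LINT u:{0<..<1}|lborel. of_real u powr (a - 1) * of_real (1 - u) powr (b - 1)) = Beta a b"
proof -
  let ?g = "\<lambda>u::real. complex_of_real u powr (a - 1)" and ?h = "hyp_coeff (1 - b) 1 1"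
  have gk: "?g u * of_real u ^ k = of_real u powr (a + of_nat k - 1)" if "u \<in> {0<..<1}" for u k
    using powr_mult_power_of_real[of u "a - 1" k] that by (simp add: algebra_simps)
  have int: "set_integrable lborel {0<..<1} (\<lambda>u. ?g u * of_real u ^ k)" for k
    using powr_integral_Ioo(1)[of "a + of_nat k"] assms(1) gk
    by (subst set_integrable_cong[OF refl refl gk]) auto
  have val: "(LINT u:{0<..<1}|lborel. ?g u * of_real u ^ k) = 1 / (a + of_nat k)" for k
    using powr_integral_Ioo(2)[of "a + of_nat k"] assms(1) gk
    by (subst set_lebesgue_integral_cong[of _ _ _ "\<lambda>u. of_real u powr (a + of_nat k - 1)"]) auto
  have nval: "(LINT u:{0<..<1}|lborel. cmod (?g u) * u ^ k) = 1 / (Re a + real k)" for k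
  proof -
    have "(LINT u:{0<..<1}|lborel. cmod (?g u) * u ^ k) = (LINT u:{0<..<1}|lborel. u powr ((Re a + real k) - 1))"
    proof (intro set_lebesgue_integral_cong allI impI)
      fix u :: real assume u: "u \<in> {0<..<1}"
      then have "cmod (?g u) * u ^ k = u powr (Re a - 1) * u powr (real k)"
        by (simp add: norm_powr_real_powr powr_realpow)
      also have "\<dots> = u powr ((Re a + real k) - 1)" by (simp add: algebra_simps flip: powr_add)
      finally show "cmod (?g u) * u ^ k = u powr ((Re a + real k) - 1)" .
    qed simp
    then show ?thesis using powr_integral_Ioo_real[of "Re a + real k"] assms(1) by simp
  qed
  have sm: "summable (\<lambda>k. cmod (?h k) * u ^ k)" if "0 < u" "u < 1" for u
    using that by (intro summable_hyp_coeff_power) auto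
  \<comment> \<open>The series of absolute values is again of hypergeometric type, with \<open>a\<close> replaced by its real part.\<close>
  let ?r = "complex_of_real (Re a)"
  have "cmod (?h k) * (1 / (Re a + real k)) = 1 / Re a * cmod (hyp_coeff (1 - b) ?r (?r + 1) k)" for k
  proof -
    have "Re a + real k = cmod (?r + of_nat k)"
      using assms(1) by (metis abs_of_nonneg add_nonneg_nonneg less_imp_le norm_of_real of_nat_0_le_iff of_real_add of_real_of_nat_eq)
    then have "cmod (?h k) * (1 / (Re a + real k)) = cmod (?h k / (?r + of_nat k))"
      by (simp add: norm_divide)
    also have "\<dots> = 1 / Re a * cmod (hyp_coeff (1 - b) ?r (?r + 1) k)"
      using assms(1) by (subst hyp_coeff_divide_shift) (auto simp: norm_divide norm_mult)
    finally show ?thesis .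
  qed
  moreover have "summable (\<lambda>k. cmod (hyp_coeff (1 - b) ?r (?r + 1) k))"
    using assms by (intro summable_norm_hyp_coeff not_nonpos_Int_if_Re_pos) auto
  ultimately have si: "summable (\<lambda>k. cmod (?h k) * (LINT u:{0<..<1}|lborel. cmod (?g u) * u ^ k))"
    unfolding nval by (simp add: summable_mult)
  note * = power_series_integral_Ioo[OF int sm si]
  have bin: "?g u * (\<Sum>k. ?h k * of_real u ^ k) = ?g u * of_real (1 - u) powr (b - 1)" if "u \<in> {0<..<1}" for u
    using that by (subst binomial_series_hyp_coeff) auto
  show "set_integrable lborel {0<..<1} (\<lambda>u. ?g u * of_real (1 - u) powr (b - 1))"
    by (rule iffD1[OF set_integrable_cong[OF refl refl bin] *(1)])
  have "(LINT u:{0<..<1}|lborel. ?g u * of_real (1 - u) powr (b - 1))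
      = (LINT u:{0<..<1}|lborel. ?g u * (\<Sum>k. ?h k * of_real u ^ k))"
    by (intro set_lebesgue_integral_cong) (auto simp: bin)
  also have "\<dots> = (\<Sum>k. 1 / a * hyp_coeff (1 - b) a (a + 1) k)"
    using *(2) unfolding val by (simp add: sums_iff hyp_coeff_divide_shift[OF assms(1)])
  also have "\<dots> = 1 / a * (\<Sum>k. hyp_coeff (1 - b) a (a + 1) k)"
    using assms by (intro suminf_mult summable_norm_cancel[OF summable_norm_hyp_coeff] not_nonpos_Int_if_Re_pos) auto
  also have "\<dots> = 1 / a * (Gamma (a + 1) * Gamma b * rGamma (a + b))"
    using assms by (subst Gauss_summation) (auto simp: algebra_simps)
  also have "\<dots> = Beta a b"
    using assms not_nonpos_Int_if_Re_pos[OF assms(1)] by (subst Gamma_plus1) (auto simp: Beta_altdef)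
  finally show "(LINT u:{0<..<1}|lborel. ?g u * of_real (1 - u) powr (b - 1)) = Beta a b" .
qed

lemma Beta_plus_nat:
  assumes "Re c > 0" "Re d > 0"
  shows "Beta (c + of_nat k) d = Beta c d * hyp_coeff c 1 (c + d) k"
proof -
  have "c \<notin> \<int>\<^sub>\<le>\<^sub>0" "c + d \<notin> \<int>\<^sub>\<le>\<^sub>0" using assms by (auto intro!: not_nonpos_Int_if_Re_pos)
  then have "pochhammer c k * Gamma c = Gamma (c + of_nat k)" "pochhammer (c + d) k \<noteq> 0"
    by (simp add: pochhammer_Gamma Gamma_eq_zero_iff) (use \<open>c + d \<notin> _\<close> in \<open>auto simp: pochhammer_eq_0_iff\<close>)
  moreover have "rGamma (c + d) = pochhammer (c + d) k * rGamma (c + d + of_nat k)"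
    by (rule pochhammer_rGamma)
  ultimately show ?thesis
    by (simp add: Beta_altdef hyp_coeff_def pochhammer_fact[symmetric] add_ac) (simp add: mult_ac)
qed

text \<open>
  Termwise Beta integration replaces the lower parameter \<open>c\<close> of the series by \<open>c + d\<close> and evaluates it at 1,
  where Gauss's theorem applies.  The condition \<open>Re (c + d - a - b) > 0\<close> is the one for convergence of
  Gauss's series.
\<close>

theorem hyp_Euler_integral:
  assumes "Re c > 0" "Re d > 0" "Re (c + d - a - b) > 0"
  defines "f \<equiv> (\<lambda>u. of_real u powr (c - 1) * of_real (1 - u) powr (d - 1) * Gauss_2F1 a b c (of_real u))"
  shows "set_integrable lborel {0<..<1} f"
    and "(LINT u:{0<..<1}|lborel. f u)
      = Gamma c * Gamma d * Gamma (c + d - a - b) * rGamma (c + d - a) * rGamma (c + d - b)"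
proof -
  let ?g = "\<lambda>u::real. complex_of_real u powr (c - 1) * of_real (1 - u) powr (d - 1)" and ?h = "hyp_coeff a b c"
  have c: "c \<notin> \<int>\<^sub>\<le>\<^sub>0" using assms by (intro not_nonpos_Int_if_Re_pos)
  have f: "f = (\<lambda>u. ?g u * (\<Sum>k. ?h k * of_real u ^ k))"
    by (simp add: fun_eq_iff f_def Gauss_2F1_def eval_fps_def hyp_coeff_def)
  have gk: "?g u * of_real u ^ k = of_real u powr (c + of_nat k - 1) * of_real (1 - u) powr (d - 1)" if "u \<in> {0<..<1}" for u k
    using powr_mult_power_of_real[of u "c - 1" k] that by (simp add: algebra_simps)
  have int: "set_integrable lborel {0<..<1} (\<lambda>u. ?g u * of_real u ^ k)" for k
    using Beta_integral_complex(1)[of "c + of_nat k" d] assms gk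
    by (subst set_integrable_cong[OF refl refl gk]) auto
  have val: "(LINT u:{0<..<1}|lborel. ?g u * of_real u ^ k) = Beta (c + of_nat k) d" for k
  proof -
    have "(LINT u:{0<..<1}|lborel. ?g u * of_real u ^ k) =
        (LINT u:{0<..<1}|lborel. of_real u powr (c + of_nat k - 1) * of_real (1 - u) powr (d - 1))"
      by (intro set_lebesgue_integral_cong allI impI gk) auto
    then show ?thesis using Beta_integral_complex(2)[of "c + of_nat k" d] assms by simp
  qed
  \<comment> \<open>Taking absolute values replaces \<open>c\<close> and \<open>d\<close> by their real parts, so the norms are Beta values too.\<close>
  let ?c = "complex_of_real (Re c)" and ?d = "complex_of_real (Re d)"
  have nval: "(LINT u:{0<..<1}|lborel. cmod (?g u) * u ^ k) = cmod (Beta ?c ?d) * cmod (hyp_coeff ?c 1 (?c + ?d) k)" for k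
  proof -
    have "complex_of_real (LINT u:{0<..<1}|lborel. cmod (?g u) * u ^ k)
        = (LINT u:{0<..<1}|lborel. complex_of_real (cmod (?g u) * u ^ k))"
      by (simp add: set_lebesgue_integral_def scaleR_conv_of_real flip: integral_complex_of_real)
    also have "\<dots> = (LINT u:{0<..<1}|lborel. of_real u powr (?c + of_nat k - 1) * of_real (1 - u) powr (?d - 1))"
    proof (intro set_lebesgue_integral_cong allI impI)
      fix u :: real assume u: "u \<in> {0<..<1}"
      have "cmod (?g u) * u ^ k = (u powr (Re c - 1) * u powr real k) * (1 - u) powr (Re d - 1)"
        using u by (simp add: norm_mult norm_powr_real_powr powr_realpow del: of_real_diff)
      also have "u powr (Re c - 1) * u powr real k = u powr (Re c + real k - 1)"
        by (simp add: algebra_simps flip: powr_add)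
      also have "complex_of_real (u powr (Re c + real k - 1) * (1 - u) powr (Re d - 1))
          = of_real u powr of_real (Re c + real k - 1) * of_real (1 - u) powr of_real (Re d - 1)"
        using u by (simp add: powr_of_real del: of_real_diff of_real_add)
      also have "\<dots> = of_real u powr (?c + of_nat k - 1) * of_real (1 - u) powr (?d - 1)" by simp
      finally show "complex_of_real (cmod (?g u) * u ^ k)
        = of_real u powr (?c + of_nat k - 1) * of_real (1 - u) powr (?d - 1)" .
    qed simp
    also have "\<dots> = Beta (?c + of_nat k) ?d"
      using assms by (intro Beta_integral_complex) auto
    also have "\<dots> = Beta ?c ?d * hyp_coeff ?c 1 (?c + ?d) k"
      using assms by (intro Beta_plus_nat) auto
    finally have "cmod (complex_of_real (LINT u:{0<..<1}|lborel. cmod (?g u) * u ^ k))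
       = cmod (Beta ?c ?d) * cmod (hyp_coeff ?c 1 (?c + ?d) k)" by (simp only: norm_mult)
    moreover have "(LINT u:{0<..<1}|lborel. cmod (?g u) * u ^ k) \<ge> 0"
      unfolding set_lebesgue_integral_def by (intro Bochner_Integration.integral_nonneg) (auto split: split_indicator)
    ultimately show ?thesis by simp
  qed
  have sm: "summable (\<lambda>k. cmod (?h k) * u ^ k)" if "0 < u" "u < 1" for u
    using that c by (intro summable_hyp_coeff_power) auto
  have si: "summable (\<lambda>k. cmod (?h k) * (LINT u:{0<..<1}|lborel. cmod (?g u) * u ^ k))"
  proof -
    obtain C where C: "C > 0" "\<And>k. cmod (?h k) \<le> C * real (k + 1) powr (Re (a + b - c) - 1)"
      using hyp_coeff_bound[OF c] by metis
    have "?c + ?d \<notin> \<int>\<^sub>\<le>\<^sub>0" using assms by (intro not_nonpos_Int_if_Re_pos) auto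
    then obtain D where D: "D > 0" "\<And>k. cmod (hyp_coeff ?c 1 (?c + ?d) k)
        \<le> D * real (k + 1) powr (Re (?c + 1 - (?c + ?d)) - 1)"
      using hyp_coeff_bound[of "?c + ?d" ?c 1] by metis
    define p where "p = Re (a + b - c) - 1 + (Re (?c + 1 - (?c + ?d)) - 1)"
    have "summable (\<lambda>k. cmod (Beta ?c ?d) * C * D * real (k + 1) powr p)"
      using assms by (intro summable_mult summable_Suc_powr) (simp add: p_def)
    then show ?thesis
    proof (rule summable_comparison_test'[where N = 0])
      fix k :: nat
      have "cmod (?h k) * (cmod (Beta ?c ?d) * cmod (hyp_coeff ?c 1 (?c + ?d) k))
         \<le> (C * real (k + 1) powr (Re (a + b - c) - 1)) *
           (cmod (Beta ?c ?d) * (D * real (k + 1) powr (Re (?c + 1 - (?c + ?d)) - 1)))"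
        using C(1) by (intro mult_mono mult_left_mono C(2) D(2)) auto
      also have "\<dots> = cmod (Beta ?c ?d) * C * D * real (k + 1) powr p"
        unfolding p_def by (simp only: powr_add mult_ac)
      finally show "norm (cmod (?h k) * (LINT u:{0<..<1}|lborel. cmod (?g u) * u ^ k))
          \<le> cmod (Beta ?c ?d) * C * D * real (k + 1) powr p"
        unfolding nval by simp
    qed
  qed
  note * = power_series_integral_Ioo[OF int sm si]
  show "set_integrable lborel {0<..<1} f" using *(1) by (simp only: f)
  have cd: "pochhammer c k \<noteq> 0" for k using c by (auto simp: pochhammer_eq_0_iff)
  have "(LINT u:{0<..<1}|lborel. f u) = (\<Sum>k. ?h k * Beta (c + of_nat k) d)"
    using *(2) unfolding val f by (simp add: sums_iff)
  also have "\<dots> = (\<Sum>k. Beta c d * hyp_coeff a b (c + d) k)"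
    using assms cd by (intro suminf_cong) (simp add: Beta_plus_nat hyp_coeff_def pochhammer_fact[symmetric] mult_ac)
  also have "\<dots> = Beta c d * (\<Sum>k. hyp_coeff a b (c + d) k)"
    using assms by (intro suminf_mult summable_norm_cancel[OF summable_norm_hyp_coeff] not_nonpos_Int_if_Re_pos) auto
  also have "\<dots> = Beta c d * (Gamma (c + d) * Gamma (c + d - a - b) * rGamma (c + d - a) * rGamma (c + d - b))"
    using assms by (subst Gauss_summation) auto
  also have "\<dots> = Gamma c * Gamma d * (Gamma (c + d) * rGamma (c + d)) * Gamma (c + d - a - b) * rGamma (c + d - a) * rGamma (c + d - b)"
    by (simp only: Beta_altdef mult_ac)
  also have "Gamma (c + d) * rGamma (c + d) = 1"
    using not_nonpos_Int_if_Re_pos[of "c + d"] assms by (simp add: Gamma_def rGamma_eq_zero_iff)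
  finally show "(LINT u:{0<..<1}|lborel. f u)
      = Gamma c * Gamma d * Gamma (c + d - a - b) * rGamma (c + d - a) * rGamma (c + d - b)" by simp
qed

lemma borel_measurable_Gauss_2F1_of_real [measurable]:
  assumes [measurable]: "f \<in> borel_measurable M"
  shows "(\<lambda>x. Gauss_2F1 a b c (of_real (f x))) \<in> borel_measurable M"
  unfolding Gauss_2F1_def eval_fps_def by measurable

definition Saigo_weight :: "complex \<Rightarrow> complex \<Rightarrow> complex \<Rightarrow> real \<Rightarrow> real \<Rightarrow> complex" where
  "Saigo_weight \<alpha> \<beta> \<gamma> x t = of_real (t - x) powr (\<alpha> - 1) * of_real t powr (- \<alpha> - \<beta>) *
     Gauss_2F1 (\<alpha> + \<beta>) (- \<gamma>) \<alpha> (of_real (1 - x / t))"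

lemma borel_measurable_Saigo_weight [measurable]:
  "Saigo_weight \<alpha> \<beta> \<gamma> x \<in> borel_measurable borel"
  unfolding Saigo_weight_def[abs_def] by measurable

lemma image_one_minus_divide:
  assumes "x > (0::real)"
  shows "(\<lambda>t. 1 - x / t) ` {x<..} = {0<..<1}"
proof (intro equalityI subsetI)
  fix u assume "u \<in> {0<..<1::real}"
  then have "x / (1 - u) \<in> {x<..}" "u = 1 - x / (x / (1 - u))"
    using assms by (auto simp: field_simps)
  then show "u \<in> (\<lambda>t. 1 - x / t) ` {x<..}" by blast
qed (use assms in \<open>auto simp: field_simps\<close>)

text \<open>
  The substitution \<open>u = 1 - x / t\<close> maps \<open>(x, \<infinity>)\<close> onto the unit interval and turns the integral into Euler's
  integral with \<open>c = \<alpha>\<close> and \<open>d = \<beta> + r\<close>.  The three hypotheses on real parts make its three conditions.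
\<close>

theorem Saigo_weight_power_integral:
  assumes "Re \<alpha> > 0" "Re (\<beta> + r) > 0" "Re (\<gamma> + r) > 0" "x > 0"
  shows "set_integrable lborel {x<..} (\<lambda>t. Saigo_weight \<alpha> \<beta> \<gamma> x t * of_real t powr (- r))"
    and "(LINT t:{x<..}|lborel. Saigo_weight \<alpha> \<beta> \<gamma> x t * of_real t powr (- r))
      = Gamma \<alpha> * (of_real x powr (- \<beta> - r) *
          (Gamma (\<beta> + r) * Gamma (\<gamma> + r) * rGamma r * rGamma (\<alpha> + \<beta> + \<gamma> + r)))"
proof -
  define f where "f u = of_real u powr (\<alpha> - 1) * of_real (1 - u) powr (\<beta> + r - 1) *
      Gauss_2F1 (\<alpha> + \<beta>) (- \<gamma>) \<alpha> (of_real u)" for u :: real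
  let ?w = "\<lambda>t. Saigo_weight \<alpha> \<beta> \<gamma> x t * of_real t powr (- r)"
  let ?I = "Gamma \<alpha> * (Gamma (\<beta> + r) * Gamma (\<gamma> + r) * rGamma r * rGamma (\<alpha> + \<beta> + \<gamma> + r))"
  have par: "\<alpha> + (\<beta> + r) - (\<alpha> + \<beta>) - - \<gamma> = \<gamma> + r" "\<alpha> + (\<beta> + r) - (\<alpha> + \<beta>) = r"
      "\<alpha> + (\<beta> + r) - - \<gamma> = \<alpha> + \<beta> + \<gamma> + r" by simp_all
  have E: "set_integrable lborel {0<..<1} f" "(LINT u:{0<..<1}|lborel. f u) = ?I"
    using hyp_Euler_integral[of \<alpha> "\<beta> + r" "\<alpha> + \<beta>" "- \<gamma>"] assms
    unfolding par f_def[abs_def] by (simp_all add: mult_ac add.commute[of r \<gamma>])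
  have mf: "(\<lambda>u. indicator {0<..<1} u *\<^sub>R f u) \<in> borel_measurable borel"
    unfolding f_def by measurable
  have f1: "f absolutely_integrable_on {0<..<1}" "integral {0<..<1} f = ?I"
    using E set_lborel_iff_lebesgue[OF mf] by auto
  have inj: "inj_on (\<lambda>t. 1 - x / t) {x<..}"
    using assms(4) by (auto intro!: inj_onI)
  have der: "((\<lambda>t. 1 - x / t) has_field_derivative x / t\<^sup>2) (at t within {x<..})" if "t \<in> {x<..}" for t
    using that assms(4) by (auto intro!: derivative_eq_intros simp: power2_eq_square)
  have CV: "(\<lambda>t. \<bar>x / t\<^sup>2\<bar> *\<^sub>R f (1 - x / t)) absolutely_integrable_on {x<..} \<and>
      integral {x<..} (\<lambda>t. \<bar>x / t\<^sup>2\<bar> *\<^sub>R f (1 - x / t)) = ?I"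
    using has_absolute_integral_change_of_variables_real[OF _ der inj, of f ?I] f1
    unfolding image_one_minus_divide[OF assms(4)] by simp
  have eq: "\<bar>x / t\<^sup>2\<bar> *\<^sub>R f (1 - x / t) = of_real x powr (\<beta> + r) * ?w t" if "t \<in> {x<..}" for t
  proof -
    have t: "t > 0" "t > x" using that assms(4) by auto
    have p: "of_real s powr z = exp (z * of_real (ln s))" if "s > 0" for s :: real and z :: complex
      using that by (simp add: powr_def Ln_of_real)
    \<comment> \<open>All factors are written as exponentials of \<open>ln x\<close>, \<open>ln t\<close> and \<open>ln (t - x)\<close>, and exponents are compared.\<close>
    have l: "ln (1 - x / t) = ln (t - x) - ln t" "ln (x / t) = ln x - ln t"
      using t assms(4) ln_divide_pos[of "t - x" t] ln_divide_pos[of x t]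
      by (simp_all add: diff_divide_distrib)
    have pos: "1 - x / t > 0" using t assms(4) by auto
    have j: "complex_of_real \<bar>x / t\<^sup>2\<bar> = exp (of_real (ln x) - 2 * of_real (ln t))"
    proof -
      have "\<bar>x / t\<^sup>2\<bar> = exp (ln x - 2 * ln t)"
        using t assms(4) by (simp add: exp_diff exp_double)
      then show ?thesis by (simp add: exp_of_real[symmetric])
    qed
    let ?F = "Gauss_2F1 (\<alpha> + \<beta>) (- \<gamma>) \<alpha> (of_real (1 - x / t))"
    have xt: "x / t > 0" "t - x > 0" using t assms(4) by auto
    have "\<bar>x / t\<^sup>2\<bar> *\<^sub>R f (1 - x / t)
        = of_real \<bar>x / t\<^sup>2\<bar> * (of_real (1 - x / t) powr (\<alpha> - 1) * of_real (x / t) powr (\<beta> + r - 1) * ?F)"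
      by (simp add: f_def scaleR_conv_of_real)
    also have "\<dots> = exp (of_real (ln x) - 2 * of_real (ln t)) *
        (exp ((\<alpha> - 1) * of_real (ln (t - x) - ln t)) * exp ((\<beta> + r - 1) * of_real (ln x - ln t))) * ?F"
      unfolding j p[OF pos] p[OF xt(1)] l by (simp only: mult_ac)
    also have "exp (of_real (ln x) - 2 * of_real (ln t)) *
        (exp ((\<alpha> - 1) * of_real (ln (t - x) - ln t)) * exp ((\<beta> + r - 1) * of_real (ln x - ln t)))
        = exp ((\<beta> + r) * of_real (ln x)) * (exp ((\<alpha> - 1) * of_real (ln (t - x)))
            * exp ((- \<alpha> - \<beta>) * of_real (ln t)) * exp (- r * of_real (ln t)))"
      by (simp add: algebra_simps flip: exp_add)
    also have "\<dots> * ?F = of_real x powr (\<beta> + r) * ?w t"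
      unfolding Saigo_weight_def p[OF xt(2)] p[OF t(1)] p[OF assms(4)] by (simp only: mult_ac)
    finally show ?thesis .
  qed
  have 2: "(\<lambda>t. of_real x powr (\<beta> + r) * ?w t) absolutely_integrable_on {x<..}"
    by (rule iffD1[OF set_integrable_cong[OF refl refl eq] CV[THEN conjunct1]])
  have "integral {x<..} (\<lambda>t. of_real x powr (\<beta> + r) * ?w t)
      = integral {x<..} (\<lambda>t. \<bar>x / t\<^sup>2\<bar> *\<^sub>R f (1 - x / t))"
    by (rule Henstock_Kurzweil_Integration.integral_cong) (simp only: eq)
  with CV have CV': "integral {x<..} (\<lambda>t. of_real x powr (\<beta> + r) * ?w t) = ?I" by simp
  have mw: "(\<lambda>u. indicator {x<..} u *\<^sub>R (of_real x powr (\<beta> + r) * ?w u)) \<in> borel_measurable borel"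
    by measurable
  have 3: "set_integrable lborel {x<..} (\<lambda>t. of_real x powr (\<beta> + r) * ?w t)"
      "(LINT t:{x<..}|lborel. of_real x powr (\<beta> + r) * ?w t) = ?I"
    using 2 CV' set_lborel_iff_lebesgue[OF mw] by auto
  have x0: "complex_of_real x powr (\<beta> + r) \<noteq> 0" using assms(4) by (simp add: powr_def)
  show "set_integrable lborel {x<..} ?w" using 3(1) x0 by simp
  have "of_real x powr (\<beta> + r) * (LINT t:{x<..}|lborel. ?w t) = ?I" using 3(2) by simp
  then have "(LINT t:{x<..}|lborel. ?w t) = ?I / of_real x powr (\<beta> + r)"
    using x0 by (simp add: field_simps)
  also have "\<dots> = Gamma \<alpha> * (of_real x powr (- \<beta> - r) *
          (Gamma (\<beta> + r) * Gamma (\<gamma> + r) * rGamma r * rGamma (\<alpha> + \<beta> + \<gamma> + r)))"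
    using powr_minus_divide[of "complex_of_real x" "\<beta> + r"] by simp
  finally show "(LINT t:{x<..}|lborel. ?w t) = Gamma \<alpha> * (of_real x powr (- \<beta> - r) *
          (Gamma (\<beta> + r) * Gamma (\<gamma> + r) * rGamma r * rGamma (\<alpha> + \<beta> + \<gamma> + r)))" .
qed

section \<open>Absolute convergence of the contour integral\<close>

text \<open>
  Growth of at most \<open>|\<tau>|\<close> to the power \<open>p\<close> with exponential decay at rate \<open>\<pi> D / 2\<close> in both directions.  With
  this normalisation the orders of the Gamma factors add up to the numbers \<open>\<Omega>\<close> and \<open>\<Delta>\<close> of the
  kernel.  Negative \<open>D\<close> means exponential growth.
\<close>

definition vertical_order :: "(real \<Rightarrow> complex) \<Rightarrow> real \<Rightarrow> real \<Rightarrow> bool" where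
  "vertical_order f p D \<longleftrightarrow>
     (\<exists>C>0. \<forall>\<tau>. cmod (f \<tau>) \<le> C * (1 + \<bar>\<tau>\<bar>) powr p * exp (- (pi / 2) * D * \<bar>\<tau>\<bar>))"

lemma vertical_order_const_1: "vertical_order (\<lambda>_. 1) 0 0"
  unfolding vertical_order_def by (intro exI[of _ 1]) auto

lemma vertical_order_mult:
  assumes "vertical_order f p D" "vertical_order g q E"
  shows "vertical_order (\<lambda>\<tau>. f \<tau> * g \<tau>) (p + q) (D + E)"
proof -
  obtain A where A: "A > 0" "\<And>\<tau>. cmod (f \<tau>) \<le> A * (1 + \<bar>\<tau>\<bar>) powr p * exp (- (pi / 2) * D * \<bar>\<tau>\<bar>)"
    using assms(1) unfolding vertical_order_def by metis
  obtain B where B: "B > 0" "\<And>\<tau>. cmod (g \<tau>) \<le> B * (1 + \<bar>\<tau>\<bar>) powr q * exp (- (pi / 2) * E * \<bar>\<tau>\<bar>)"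
    using assms(2) unfolding vertical_order_def by metis
  have "cmod (f \<tau> * g \<tau>) \<le> (A * B) * (1 + \<bar>\<tau>\<bar>) powr (p + q) * exp (- (pi / 2) * (D + E) * \<bar>\<tau>\<bar>)" for \<tau>
  proof -
    have "cmod (f \<tau> * g \<tau>) \<le> (A * (1 + \<bar>\<tau>\<bar>) powr p * exp (- (pi / 2) * D * \<bar>\<tau>\<bar>)) *
        (B * (1 + \<bar>\<tau>\<bar>) powr q * exp (- (pi / 2) * E * \<bar>\<tau>\<bar>))"
      unfolding norm_mult using A(1) by (intro mult_mono A(2) B(2)) auto
    also have "\<dots> = (A * B) * ((1 + \<bar>\<tau>\<bar>) powr p * (1 + \<bar>\<tau>\<bar>) powr q) *
        (exp (- (pi / 2) * D * \<bar>\<tau>\<bar>) * exp (- (pi / 2) * E * \<bar>\<tau>\<bar>))" by (simp only: mult_ac)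
    also have "\<dots> = (A * B) * (1 + \<bar>\<tau>\<bar>) powr (p + q) * exp (- (pi / 2) * (D + E) * \<bar>\<tau>\<bar>)"
      by (simp add: powr_add algebra_simps add_divide_distrib flip: exp_add)
    finally show ?thesis .
  qed
  then show ?thesis unfolding vertical_order_def using A(1) B(1) by (intro exI[of _ "A * B"]) auto
qed

lemma vertical_order_prod_list:
  assumes "\<And>x. x \<in> set xs \<Longrightarrow> vertical_order (F x) (p x) (D x)"
  shows "vertical_order (\<lambda>\<tau>. \<Prod>x\<leftarrow>xs. F x \<tau>) (\<Sum>x\<leftarrow>xs. p x) (\<Sum>x\<leftarrow>xs. D x)"
  using assms
  by (induction xs) (auto intro!: vertical_order_mult vertical_order_const_1)

lemma inverse_prod_list:
  "inverse (\<Prod>x\<leftarrow>xs. f x) = (\<Prod>x\<leftarrow>xs. inverse (f x :: complex))"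
  by (induction xs) auto

text \<open>
  Passing from \<open>\<phi>\<close> to \<open>\<phi>(e + d \<tau>)\<close> to the power \<open>\<kappa>\<close>, as needed for \<open>\<Gamma>\<^sup>\<kappa>(c + d s)\<close> on the imaginary axis.  The sign
  \<open>\<sigma>\<close> covers \<open>\<Gamma>\<close> (decay) and \<open>1 / \<Gamma>\<close> (growth) at once.
\<close>

lemma vertical_order_powr_affine:
  fixes f :: "real \<Rightarrow> complex" and \<phi> :: "real \<Rightarrow> real"
  assumes \<phi>: "\<exists>C>0. \<forall>y. \<phi> y \<le> C * (1 + \<bar>y\<bar>) powr p * exp (- \<sigma> * (pi / 2) * \<bar>y\<bar>)" "\<And>y. \<phi> y \<ge> 0"
    and f: "\<And>\<tau>. cmod (f \<tau>) = \<phi> (e + d * \<tau>) powr \<kappa>"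
    and d: "d \<noteq> 0" and \<kappa>: "\<kappa> > 0"
  shows "vertical_order f (\<kappa> * p) (\<sigma> * \<kappa> * \<bar>d\<bar>)"
proof -
  obtain C where C: "C > 0" "\<And>y. \<phi> y \<le> C * (1 + \<bar>y\<bar>) powr p * exp (- \<sigma> * (pi / 2) * \<bar>y\<bar>)"
    using \<phi>(1) by metis
  \<comment> \<open>This \<open>k\<close> satisfies both \<open>1 + |e + d \<tau>| \<le> k (1 + |\<tau>|)\<close> and \<open>1 + |\<tau>| \<le> k (1 + |e + d \<tau>|)\<close>.\<close>
  define k where "k = (1 + \<bar>e\<bar> + \<bar>d\<bar>) + (1 + 1 / \<bar>d\<bar> + \<bar>e\<bar> / \<bar>d\<bar>)"
  define M where "M = C * k powr \<bar>p\<bar> * exp (\<bar>\<sigma>\<bar> * (pi / 2) * \<bar>e\<bar>)"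
  have k: "k > 0" unfolding k_def by (intro add_pos_nonneg) auto
  have M: "M > 0" using C(1) k by (simp add: M_def)
  have bound: "\<phi> (e + d * \<tau>) \<le> M * (1 + \<bar>\<tau>\<bar>) powr p * exp (- \<sigma> * (pi / 2) * (\<bar>d\<bar> * \<bar>\<tau>\<bar>))" for \<tau>
  proof -
    let ?y = "e + d * \<tau>"
    have y1: "\<bar>?y\<bar> \<le> \<bar>e\<bar> + \<bar>d\<bar> * \<bar>\<tau>\<bar>" and y2: "\<bar>d\<bar> * \<bar>\<tau>\<bar> \<le> \<bar>?y\<bar> + \<bar>e\<bar>"
      by (simp_all flip: abs_mult)
    have "1 + \<bar>?y\<bar> \<le> (1 + \<bar>e\<bar> + \<bar>d\<bar>) * (1 + \<bar>\<tau>\<bar>)"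
    proof -
      have "(1 + \<bar>e\<bar> + \<bar>d\<bar>) * (1 + \<bar>\<tau>\<bar>) = 1 + (\<bar>e\<bar> + \<bar>d\<bar> * \<bar>\<tau>\<bar>) + (\<bar>d\<bar> + \<bar>\<tau>\<bar> + \<bar>e\<bar> * \<bar>\<tau>\<bar>)"
        by (simp add: algebra_simps)
      moreover have "0 \<le> \<bar>d\<bar> + \<bar>\<tau>\<bar> + \<bar>e\<bar> * \<bar>\<tau>\<bar>" by simp
      ultimately show ?thesis using y1 by linarith
    qed
    also have "\<dots> \<le> k * (1 + \<bar>\<tau>\<bar>)" unfolding k_def by (intro mult_right_mono) auto
    finally have k1: "1 + \<bar>?y\<bar> \<le> k * (1 + \<bar>\<tau>\<bar>)" .
    have "\<bar>\<tau>\<bar> = \<bar>d\<bar> * \<bar>\<tau>\<bar> / \<bar>d\<bar>" using d by simp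
    also have "\<dots> \<le> (\<bar>?y\<bar> + \<bar>e\<bar>) / \<bar>d\<bar>" using y2 by (intro divide_right_mono) auto
    finally have "1 + \<bar>\<tau>\<bar> \<le> 1 + (\<bar>?y\<bar> + \<bar>e\<bar>) / \<bar>d\<bar>" by simp
    also have "\<dots> \<le> (1 + 1 / \<bar>d\<bar> + \<bar>e\<bar> / \<bar>d\<bar>) * (1 + \<bar>?y\<bar>)"
    proof -
      have "(1 + 1 / \<bar>d\<bar> + \<bar>e\<bar> / \<bar>d\<bar>) * (1 + \<bar>?y\<bar>)
          = (1 + (\<bar>?y\<bar> + \<bar>e\<bar>) / \<bar>d\<bar>) + (\<bar>?y\<bar> + 1 / \<bar>d\<bar> + \<bar>e\<bar> / \<bar>d\<bar> * \<bar>?y\<bar>)"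
        by (simp add: algebra_simps add_divide_distrib)
      moreover have "0 \<le> \<bar>?y\<bar> + 1 / \<bar>d\<bar> + \<bar>e\<bar> / \<bar>d\<bar> * \<bar>?y\<bar>" by simp
      ultimately show ?thesis by linarith
    qed
    also have "\<dots> \<le> k * (1 + \<bar>?y\<bar>)" unfolding k_def by (intro mult_right_mono) auto
    finally have k2: "1 + \<bar>\<tau>\<bar> \<le> k * (1 + \<bar>?y\<bar>)" .
    have P: "(1 + \<bar>?y\<bar>) powr p \<le> k powr \<bar>p\<bar> * (1 + \<bar>\<tau>\<bar>) powr p"
    proof (cases "p \<ge> 0")
      case True
      then have "(1 + \<bar>?y\<bar>) powr p \<le> (k * (1 + \<bar>\<tau>\<bar>)) powr p" using k1 by (intro powr_mono2) auto
      then show ?thesis using True k by (simp add: powr_mult)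
    next
      case False
      have "(1 + \<bar>\<tau>\<bar>) / k \<le> 1 + \<bar>?y\<bar>" using k2 k by (simp add: field_simps)
      then have "(1 + \<bar>?y\<bar>) powr p \<le> ((1 + \<bar>\<tau>\<bar>) / k) powr p"
        using False k by (intro powr_mono2') auto
      then show ?thesis using False k by (simp add: powr_divide powr_minus field_simps)
    qed
    have *: "\<bar>\<bar>d\<bar> * \<bar>\<tau>\<bar> - \<bar>?y\<bar>\<bar> \<le> \<bar>e\<bar>" using y1 y2 by linarith
    have "\<sigma> * (\<bar>d\<bar> * \<bar>\<tau>\<bar> - \<bar>?y\<bar>) \<le> \<bar>\<sigma>\<bar> * \<bar>e\<bar>"
    proof -
      have "\<sigma> * (\<bar>d\<bar> * \<bar>\<tau>\<bar> - \<bar>?y\<bar>) \<le> \<bar>\<sigma> * (\<bar>d\<bar> * \<bar>\<tau>\<bar> - \<bar>?y\<bar>)\<bar>" by (rule abs_ge_self)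
      also have "\<dots> = \<bar>\<sigma>\<bar> * \<bar>\<bar>d\<bar> * \<bar>\<tau>\<bar> - \<bar>?y\<bar>\<bar>" by (rule abs_mult)
      also have "\<dots> \<le> \<bar>\<sigma>\<bar> * \<bar>e\<bar>" by (intro mult_left_mono *) simp
      finally show ?thesis .
    qed
    then have "(pi / 2) * (\<sigma> * (\<bar>d\<bar> * \<bar>\<tau>\<bar> - \<bar>?y\<bar>)) \<le> (pi / 2) * (\<bar>\<sigma>\<bar> * \<bar>e\<bar>)"
      by (intro mult_left_mono) auto
    then have "exp (- \<sigma> * (pi / 2) * \<bar>?y\<bar>) \<le> exp (\<bar>\<sigma>\<bar> * (pi / 2) * \<bar>e\<bar> + - \<sigma> * (pi / 2) * (\<bar>d\<bar> * \<bar>\<tau>\<bar>))"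
      by (subst exp_le_cancel_iff) (simp add: algebra_simps)
    then have E: "exp (- \<sigma> * (pi / 2) * \<bar>?y\<bar>) \<le> exp (\<bar>\<sigma>\<bar> * (pi / 2) * \<bar>e\<bar>) * exp (- \<sigma> * (pi / 2) * (\<bar>d\<bar> * \<bar>\<tau>\<bar>))"
      by (simp only: exp_add)
    have "\<phi> ?y \<le> C * (1 + \<bar>?y\<bar>) powr p * exp (- \<sigma> * (pi / 2) * \<bar>?y\<bar>)" by (rule C)
    also have "\<dots> \<le> C * (k powr \<bar>p\<bar> * (1 + \<bar>\<tau>\<bar>) powr p) *
        (exp (\<bar>\<sigma>\<bar> * (pi / 2) * \<bar>e\<bar>) * exp (- \<sigma> * (pi / 2) * (\<bar>d\<bar> * \<bar>\<tau>\<bar>)))"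
      using C(1) P E by (intro mult_mono mult_left_mono) auto
    also have "\<dots> = M * (1 + \<bar>\<tau>\<bar>) powr p * exp (- \<sigma> * (pi / 2) * (\<bar>d\<bar> * \<bar>\<tau>\<bar>))"
      by (simp only: M_def mult_ac)
    finally show ?thesis .
  qed
  have "cmod (f \<tau>) \<le> M powr \<kappa> * (1 + \<bar>\<tau>\<bar>) powr (\<kappa> * p) * exp (- (pi / 2) * (\<sigma> * \<kappa> * \<bar>d\<bar>) * \<bar>\<tau>\<bar>)" for \<tau>
  proof -
    have "cmod (f \<tau>) \<le> (M * (1 + \<bar>\<tau>\<bar>) powr p * exp (- \<sigma> * (pi / 2) * (\<bar>d\<bar> * \<bar>\<tau>\<bar>))) powr \<kappa>"
      unfolding f using \<kappa> by (intro powr_mono2 bound \<phi>(2)) auto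
    also have "\<dots> = M powr \<kappa> * (1 + \<bar>\<tau>\<bar>) powr (\<kappa> * p) * exp (- (pi / 2) * (\<sigma> * \<kappa> * \<bar>d\<bar>) * \<bar>\<tau>\<bar>)"
      using M by (simp add: powr_mult powr_powr mult.commute[of p]) (simp add: powr_def mult_ac)
    finally show ?thesis .
  qed
  then show ?thesis unfolding vertical_order_def using M by (intro exI[of _ "M powr \<kappa>"]) auto
qed

lemma affine_eq_Complex: "c + of_real d * (\<i> * of_real \<tau>) = Complex (Re c) (Im c + d * \<tau>)"
  by (simp add: complex_eq_iff)

lemma log_Gamma_branchD:
  assumes "log_Gamma_branch \<Lambda>" "d \<noteq> 0" "Re s = 0" "c + of_real d * s \<notin> \<int>\<^sub>\<le>\<^sub>0"
  shows "exp (\<Lambda> c d \<kappa> s) = Gamma (c + of_real d * s)"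
proof -
  let ?S = "{s. Re s = 0 \<and> c + of_real d * s \<notin> \<int>\<^sub>\<le>\<^sub>0}"
  have "\<forall>s\<in>?S. exp (\<Lambda> c d \<kappa> s) = Gamma (c + of_real d * s)"
    using assms(1)[unfolded log_Gamma_branch_def Let_def, rule_format, OF assms(2)] by (rule conjunct2)
  moreover have "s \<in> ?S" using assms(3,4) by simp
  ultimately show ?thesis by (rule bspec)
qed

text \<open>
  The modulus does not depend on the chosen branch.  At a pole both sides are 0, by the conventions for
  \<open>Gamma\<close> and \<open>Gamma_pow\<close> there.
\<close>

lemma norm_Gamma_pow:
  assumes "log_Gamma_branch \<Lambda>" "d \<noteq> 0"
  shows "cmod (Gamma_pow \<Lambda> c d \<kappa> (\<i> * of_real \<tau>)) = cmod (Gamma (Complex (Re c) (Im c + d * \<tau>))) powr \<kappa>"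
proof (cases "c + of_real d * (\<i> * of_real \<tau>) \<in> \<int>\<^sub>\<le>\<^sub>0")
  case True
  then have "Gamma (c + of_real d * (\<i> * of_real \<tau>)) = 0" by (rule Gamma_nonpos_Int)
  with True show ?thesis by (simp add: Gamma_pow_def affine_eq_Complex)
next
  case False
  then have "exp (\<Lambda> c d \<kappa> (\<i> * of_real \<tau>)) = Gamma (c + of_real d * (\<i> * of_real \<tau>))"
    using assms by (intro log_Gamma_branchD) auto
  then have "cmod (Gamma (c + of_real d * (\<i> * of_real \<tau>))) = exp (Re (\<Lambda> c d \<kappa> (\<i> * of_real \<tau>)))"
    by (metis norm_exp_eq_Re)
  with False show ?thesis by (simp add: Gamma_pow_def affine_eq_Complex powr_def)
qed

lemma vertical_order_Gamma_pow:
  assumes "log_Gamma_branch \<Lambda>" "d \<noteq> 0" "\<kappa> > 0" "Re c > 0"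
  shows "vertical_order (\<lambda>\<tau>. Gamma_pow \<Lambda> c d \<kappa> (\<i> * of_real \<tau>)) (\<kappa> * (Re c - 1/2)) (\<kappa> * \<bar>d\<bar>)"
  using vertical_order_powr_affine[of "\<lambda>y. cmod (Gamma (Complex (Re c) y))" "Re c - 1/2" 1
      "\<lambda>\<tau>. Gamma_pow \<Lambda> c d \<kappa> (\<i> * of_real \<tau>)" "Im c" d \<kappa>]
    Gamma_vertical_bound[OF assms(4)] norm_Gamma_pow[OF assms(1,2)] assms by simp

lemma vertical_order_inverse_Gamma_pow:
  assumes "log_Gamma_branch \<Lambda>" "d \<noteq> 0" "\<kappa> > 0"
  shows "vertical_order (\<lambda>\<tau>. inverse (Gamma_pow \<Lambda> c d \<kappa> (\<i> * of_real \<tau>))) (\<kappa> * (1/2 - Re c)) (- \<kappa> * \<bar>d\<bar>)"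
proof -
  have "cmod (inverse (Gamma_pow \<Lambda> c d \<kappa> (\<i> * of_real \<tau>)))
      = cmod (rGamma (Complex (Re c) (Im c + d * \<tau>))) powr \<kappa>" for \<tau>
    by (simp add: norm_inverse norm_Gamma_pow[OF assms(1,2)] rGamma_inverse_Gamma inverse_powr)
  then show ?thesis
    using vertical_order_powr_affine[of "\<lambda>y. cmod (rGamma (Complex (Re c) y))" "1/2 - Re c" "-1"
      "\<lambda>\<tau>. inverse (Gamma_pow \<Lambda> c d \<kappa> (\<i> * of_real \<tau>))" "Im c" d \<kappa>]
    rGamma_vertical_bound[of "Re c"] assms by simp
qed

text \<open>
  The branch is continuous only off the poles.  They form a closed set of parameters \<open>\<tau>\<close>, on which
  \<open>Gamma_pow\<close> vanishes.
\<close>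

lemma borel_measurable_Gamma_pow:
  assumes "log_Gamma_branch \<Lambda>" "d \<noteq> 0"
  shows "(\<lambda>\<tau>. Gamma_pow \<Lambda> c d \<kappa> (\<i> * of_real \<tau>)) \<in> borel_measurable borel"
proof -
  define S where "S = {\<tau>::real. c + of_real d * (\<i> * of_real \<tau>) \<notin> \<int>\<^sub>\<le>\<^sub>0}"
  have "S = (\<lambda>\<tau>::real. c + of_real d * (\<i> * of_real \<tau>)) -` (- \<int>\<^sub>\<le>\<^sub>0)" by (auto simp: S_def)
  moreover have "open ((\<lambda>\<tau>::real. c + of_real d * (\<i> * of_real \<tau>)) -` (- \<int>\<^sub>\<le>\<^sub>0))"
    by (intro open_vimage continuous_intros open_Compl closed_nonpos_Ints)
  ultimately have S: "S \<in> sets borel" by simp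
  have "continuous_on {s. Re s = 0 \<and> c + of_real d * s \<notin> \<int>\<^sub>\<le>\<^sub>0} (\<Lambda> c d \<kappa>)"
    using assms(1)[unfolded log_Gamma_branch_def Let_def, rule_format, OF assms(2)] by (rule conjunct1)
  then have "continuous_on S (\<lambda>\<tau>. \<Lambda> c d \<kappa> (\<i> * of_real \<tau>))"
    by (rule continuous_on_compose2) (auto intro!: continuous_intros simp: S_def)
  then have "(\<lambda>\<tau>. indicator S \<tau> *\<^sub>R exp (of_real \<kappa> * \<Lambda> c d \<kappa> (\<i> * of_real \<tau>))) \<in> borel_measurable borel"
    by (intro borel_measurable_continuous_on_indicator S continuous_intros)
  also have "(\<lambda>\<tau>. indicator S \<tau> *\<^sub>R exp (of_real \<kappa> * \<Lambda> c d \<kappa> (\<i> * of_real \<tau>)))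
      = (\<lambda>\<tau>. Gamma_pow \<Lambda> c d \<kappa> (\<i> * of_real \<tau>))"
    by (auto simp: fun_eq_iff S_def Gamma_pow_def)
  finally show ?thesis .
qed

lemma borel_measurable_prod_list:
  fixes F :: "'b \<Rightarrow> 'a \<Rightarrow> complex"
  assumes "\<And>x. x \<in> set xs \<Longrightarrow> F x \<in> borel_measurable M"
  shows "(\<lambda>\<tau>. \<Prod>x\<leftarrow>xs. F x \<tau>) \<in> borel_measurable M"
  using assms by (induction xs) auto

lemma borel_measurable_I_kernel:
  assumes \<Lambda>: "log_Gamma_branch \<Lambda>" and pars: "I_params m n as bs"
  shows "(\<lambda>\<tau>. I_kernel \<Lambda> m n as bs (\<i> * of_real \<tau>)) \<in> borel_measurable borel"
proof -
  have nz: "(c, 0, \<kappa>) \<notin> set as" "(c, 0, \<kappa>) \<notin> set bs" for c \<kappa>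
    using pars unfolding I_params_def by auto
  show ?thesis
    unfolding I_kernel_def
    by (intro borel_measurable_divide borel_measurable_times borel_measurable_prod_list)
       (auto dest!: in_set_takeD in_set_dropD intro!: borel_measurable_Gamma_pow[OF \<Lambda>] simp: nz)
qed

text \<open>
  The numbers \<open>\<Omega>\<close> and \<open>\<Delta>\<close> in the convergence conditions are the total polynomial order and the total
  exponential rate of the Gamma factors.  Separation of the poles by the contour says that every
  numerator factor has an argument of positive real part, as the upper bound for \<open>\<Gamma>\<close> demands.
\<close>

lemma vertical_order_I_kernel:
  assumes \<Lambda>: "log_Gamma_branch \<Lambda>" and pars: "I_params m n as bs" and sep: "I_separated m n as bs"
  shows "vertical_order (\<lambda>\<tau>. I_kernel \<Lambda> m n as bs (\<i> * of_real \<tau>)) (I_Omega as bs) (I_Delta m n as bs)"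
proof -
  have pos: "A > 0" "\<kappa> > 0" if "(c, A, \<kappa>) \<in> set as \<union> set bs" for c A \<kappa>
    using that pars unfolding I_params_def by auto
  have bpos: "Re b > 0" if "(b, B, \<beta>) \<in> set (take m bs)" for b B \<beta>
  proof -
    have B: "B > 0" using pos(1)[of b B \<beta>] that by (auto dest: in_set_takeD)
    \<comment> \<open>The first pole of \<open>\<Gamma>(b + B s)\<close> lies at \<open>s = - b / B\<close>, hence to the left of the axis.\<close>
    then have "b + of_real B * (- b / of_real B) \<in> \<int>\<^sub>\<le>\<^sub>0" by simp
    then have "Re (- b / of_real B) < 0" using sep that unfolding I_separated_def by fast
    then show ?thesis using B by (simp add: zero_less_divide_iff)
  qed
  have apos: "Re (1 - a) > 0" if "(a, A, \<alpha>) \<in> set (take n as)" for a A \<alpha>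
  proof -
    have A: "A > 0" using pos(1)[of a A \<alpha>] that by (auto dest: in_set_takeD)
    \<comment> \<open>Likewise the first pole of \<open>\<Gamma>(1 - a - A s)\<close> lies at \<open>s = (1 - a) / A\<close>, to the right of the axis.\<close>
    then have "1 - a - of_real A * ((1 - a) / of_real A) \<in> \<int>\<^sub>\<le>\<^sub>0" by simp
    then have "Re ((1 - a) / of_real A) > 0" using sep that unfolding I_separated_def by fast
    then show ?thesis using A by (simp add: zero_less_divide_iff)
  qed
  have 1: "vertical_order (\<lambda>\<tau>. \<Prod>(b, B, \<beta>)\<leftarrow>take m bs. Gamma_pow \<Lambda> b B \<beta> (\<i> * of_real \<tau>))
      (\<Sum>(b, B, \<beta>)\<leftarrow>take m bs. \<beta> * (Re b - 1/2)) (\<Sum>(b, B, \<beta>)\<leftarrow>take m bs. \<beta> * B)"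
  proof (rule vertical_order_prod_list, clarify)
    fix b B \<beta> assume x: "(b, B, \<beta>) \<in> set (take m bs)"
    then show "vertical_order (\<lambda>\<tau>. Gamma_pow \<Lambda> b B \<beta> (\<i> * of_real \<tau>)) (\<beta> * (Re b - 1/2)) (\<beta> * B)"
      using vertical_order_Gamma_pow[OF \<Lambda>, of B \<beta> b] pos[of b B \<beta>] bpos[OF x]
      by (auto dest: in_set_takeD)
  qed
  have 2: "vertical_order (\<lambda>\<tau>. \<Prod>(a, A, \<alpha>)\<leftarrow>take n as. Gamma_pow \<Lambda> (1 - a) (- A) \<alpha> (\<i> * of_real \<tau>))
      (\<Sum>(a, A, \<alpha>)\<leftarrow>take n as. (1/2 - Re a) * \<alpha>) (\<Sum>(a, A, \<alpha>)\<leftarrow>take n as. \<alpha> * A)"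
  proof (rule vertical_order_prod_list, clarify)
    fix a A \<alpha> assume x: "(a, A, \<alpha>) \<in> set (take n as)"
    then have p: "A > 0" "\<alpha> > 0" using pos[of a A \<alpha>] by (auto dest: in_set_takeD)
    have "\<alpha> * (Re (1 - a) - 1/2) = (1/2 - Re a) * \<alpha>" "\<alpha> * \<bar>- A\<bar> = \<alpha> * A"
      using p by (simp_all add: algebra_simps)
    then show "vertical_order (\<lambda>\<tau>. Gamma_pow \<Lambda> (1 - a) (- A) \<alpha> (\<i> * of_real \<tau>)) ((1/2 - Re a) * \<alpha>) (\<alpha> * A)"
      using vertical_order_Gamma_pow[OF \<Lambda> _ p(2) apos[OF x], of "- A"] p by (simp add: mult.commute)
  qed
  have 3: "vertical_order (\<lambda>\<tau>. \<Prod>(b, B, \<beta>)\<leftarrow>drop m bs. inverse (Gamma_pow \<Lambda> (1 - b) (- B) \<beta> (\<i> * of_real \<tau>)))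
      (\<Sum>(b, B, \<beta>)\<leftarrow>drop m bs. \<beta> * (Re b - 1/2)) (\<Sum>(b, B, \<beta>)\<leftarrow>drop m bs. - (\<beta> * B))"
  proof (rule vertical_order_prod_list, clarify)
    fix b B \<beta> assume x: "(b, B, \<beta>) \<in> set (drop m bs)"
    then have p: "B > 0" "\<beta> > 0" using pos[of b B \<beta>] by (auto dest: in_set_dropD)
    have "\<beta> * (1/2 - Re (1 - b)) = \<beta> * (Re b - 1/2)" "- \<beta> * \<bar>- B\<bar> = - (\<beta> * B)"
      using p by (simp_all add: algebra_simps)
    then show "vertical_order (\<lambda>\<tau>. inverse (Gamma_pow \<Lambda> (1 - b) (- B) \<beta> (\<i> * of_real \<tau>))) (\<beta> * (Re b - 1/2)) (- (\<beta> * B))"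
      using vertical_order_inverse_Gamma_pow[OF \<Lambda> _ p(2), of "- B" "1 - b"] p by simp
  qed
  have 4: "vertical_order (\<lambda>\<tau>. \<Prod>(a, A, \<alpha>)\<leftarrow>drop n as. inverse (Gamma_pow \<Lambda> a A \<alpha> (\<i> * of_real \<tau>)))
      (\<Sum>(a, A, \<alpha>)\<leftarrow>drop n as. (1/2 - Re a) * \<alpha>) (\<Sum>(a, A, \<alpha>)\<leftarrow>drop n as. - (\<alpha> * A))"
  proof (rule vertical_order_prod_list, clarify)
    fix a A \<alpha> assume x: "(a, A, \<alpha>) \<in> set (drop n as)"
    then have p: "A > 0" "\<alpha> > 0" using pos[of a A \<alpha>] by (auto dest: in_set_dropD)
    then show "vertical_order (\<lambda>\<tau>. inverse (Gamma_pow \<Lambda> a A \<alpha> (\<i> * of_real \<tau>))) ((1/2 - Re a) * \<alpha>) (- (\<alpha> * A))"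
      using vertical_order_inverse_Gamma_pow[OF \<Lambda> _ p(2), of A a] by (simp add: mult.commute)
  qed
  have split: "(\<Sum>x\<leftarrow>take k xs. f x) + (\<Sum>x\<leftarrow>drop k xs. f x) = (\<Sum>x\<leftarrow>xs. f x)" for k and f :: "triple \<Rightarrow> real" and xs
    by (metis append_take_drop_id map_append sum_list_append)
  have neg: "(\<Sum>(b, B, \<beta>)\<leftarrow>xs. - f b B \<beta>) = - (\<Sum>(b, B, \<beta>)\<leftarrow>xs. f b B \<beta>)" for f :: "complex \<Rightarrow> real \<Rightarrow> real \<Rightarrow> real" and xs
    by (induction xs) auto
  have neg': "(\<Sum>(b, B, \<beta>)\<leftarrow>bs. \<beta> * (Re b - 1/2)) = - (\<Sum>(b, B, \<beta>)\<leftarrow>bs. (1/2 - Re b) * \<beta>)"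
    by (subst neg[symmetric], rule arg_cong[of _ _ sum_list], rule map_cong) (auto simp: algebra_simps)
  have Om: "(\<Sum>(b, B, \<beta>)\<leftarrow>take m bs. \<beta> * (Re b - 1/2)) + (\<Sum>(a, A, \<alpha>)\<leftarrow>take n as. (1/2 - Re a) * \<alpha>)
      + ((\<Sum>(b, B, \<beta>)\<leftarrow>drop m bs. \<beta> * (Re b - 1/2)) + (\<Sum>(a, A, \<alpha>)\<leftarrow>drop n as. (1/2 - Re a) * \<alpha>)) = I_Omega as bs"
    using split[where xs = bs and k = m and f = "\<lambda>(b, B, \<beta>). \<beta> * (Re b - 1/2)"]
      split[where xs = as and k = n and f = "\<lambda>(a, A, \<alpha>). (1/2 - Re a) * \<alpha>"] neg'
    unfolding I_Omega_def by linarith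
  have De: "(\<Sum>(b, B, \<beta>)\<leftarrow>take m bs. \<beta> * B) + (\<Sum>(a, A, \<alpha>)\<leftarrow>take n as. \<alpha> * A)
      + ((\<Sum>(b, B, \<beta>)\<leftarrow>drop m bs. - (\<beta> * B)) + (\<Sum>(a, A, \<alpha>)\<leftarrow>drop n as. - (\<alpha> * A))) = I_Delta m n as bs"
    unfolding neg I_Delta_def by linarith
  have ker: "(\<lambda>\<tau>. I_kernel \<Lambda> m n as bs (\<i> * of_real \<tau>)) = (\<lambda>\<tau>.
      (\<Prod>(b, B, \<beta>)\<leftarrow>take m bs. Gamma_pow \<Lambda> b B \<beta> (\<i> * of_real \<tau>)) *
      (\<Prod>(a, A, \<alpha>)\<leftarrow>take n as. Gamma_pow \<Lambda> (1 - a) (- A) \<alpha> (\<i> * of_real \<tau>)) *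
      ((\<Prod>(b, B, \<beta>)\<leftarrow>drop m bs. inverse (Gamma_pow \<Lambda> (1 - b) (- B) \<beta> (\<i> * of_real \<tau>))) *
       (\<Prod>(a, A, \<alpha>)\<leftarrow>drop n as. inverse (Gamma_pow \<Lambda> a A \<alpha> (\<i> * of_real \<tau>)))))"
    by (simp add: I_kernel_def divide_inverse inverse_prod_list case_prod_unfold)
  show ?thesis
    unfolding ker Om[symmetric] De[symmetric] by (intro vertical_order_mult 1 2 3 4)
qed

lemma powr_le_exp:
  fixes q \<delta> :: real
  assumes "\<delta> > 0"
  shows "\<exists>C>0. \<forall>u\<ge>1. u powr q \<le> C * exp (\<delta> * u)"
proof -
  \<comment> \<open>A positive exponent \<open>r\<close> is needed to choose \<open>\<epsilon>\<close> with \<open>r \<epsilon> = \<delta>\<close>; then \<open>ln (\<epsilon> u) \<le> \<epsilon> u - 1\<close> gives the bound.\<close>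
  define r where "r = max q 1"
  have r: "r > 0" "q \<le> r" by (auto simp: r_def)
  define \<epsilon> where "\<epsilon> = \<delta> / r"
  have \<epsilon>: "\<epsilon> > 0" "r * \<epsilon> = \<delta>" using assms r by (auto simp: \<epsilon>_def)
  have "u powr q \<le> exp (- r * (1 + ln \<epsilon>)) * exp (\<delta> * u)" if "u \<ge> 1" for u
  proof -
    have "ln \<epsilon> + ln u = ln (\<epsilon> * u)" using \<epsilon> that by (simp add: ln_mult)
    also have "\<dots> \<le> \<epsilon> * u - 1" using \<epsilon> that by (intro ln_le_minus_one) auto
    finally have "r * ln u \<le> r * (\<epsilon> * u - 1 - ln \<epsilon>)" using r by (intro mult_left_mono) auto
    also have "\<dots> = (r * \<epsilon>) * u - r * (1 + ln \<epsilon>)" by (simp add: algebra_simps)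
    finally have *: "r * ln u \<le> \<delta> * u - r * (1 + ln \<epsilon>)" unfolding \<epsilon>(2) .
    have "u powr q \<le> u powr r" using r that by (intro powr_mono) auto
    also have "\<dots> = exp (r * ln u)" using that by (simp add: powr_def)
    also have "\<dots> \<le> exp (\<delta> * u - r * (1 + ln \<epsilon>))" using * by simp
    also have "\<dots> = exp (- r * (1 + ln \<epsilon>)) * exp (\<delta> * u)" by (simp flip: exp_add)
    finally show ?thesis .
  qed
  then show ?thesis by (intro exI[of _ "exp (- r * (1 + ln \<epsilon>))"]) auto
qed

lemma integrable_one_plus_abs_powr:
  fixes p :: real
  assumes "p < -1"
  shows "integrable lborel (\<lambda>\<tau>::real. (1 + \<bar>\<tau>\<bar>) powr p)"
proof -
  define h where "h t = indicator {1..} t *\<^sub>R t powr p" for t :: real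
  have m: "h \<in> borel_measurable lborel" unfolding h_def by measurable
  have "((\<lambda>t. t powr p) has_integral -(1 powr (p + 1)) / (p + 1)) {1..}"
    using assms by (intro has_integral_powr_to_inf) auto
  then have "(\<lambda>t. t powr p) absolutely_integrable_on {1..}"
    by (intro nonnegative_absolutely_integrable_1) auto
  then have h: "integrable lborel h"
    using integrable_completion[OF m] by (simp add: h_def[abs_def] set_integrable_def)
  have "integrable lborel (\<lambda>t. h (1 + 1 * t) + h (1 + (-1) * t))"
    by (intro Bochner_Integration.integrable_add lborel_integrable_real_affine h) auto
  then show ?thesis
    by (rule Bochner_Integration.integrable_bound) (auto simp: h_def abs_if split: split_indicator)
qed

text \<open>
  The two alternatives are those of the absolute convergence conditions: strict exponential decay
  beats any power, and at the boundary the power alone has to be integrable.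
\<close>

lemma integrable_if_vertical_order:
  fixes f :: "real \<Rightarrow> complex"
  assumes [measurable]: "f \<in> borel_measurable borel" and f: "vertical_order f p D"
    and cases: "\<bar>\<theta>\<bar> < pi / 2 * D \<or> \<bar>\<theta>\<bar> = pi / 2 * D \<and> p < -1"
  shows "integrable lborel (\<lambda>\<tau>. f \<tau> * exp (of_real (\<theta> * \<tau>)))"
proof -
  obtain C where C: "C > 0" "\<And>\<tau>. cmod (f \<tau>) \<le> C * (1 + \<bar>\<tau>\<bar>) powr p * exp (- (pi / 2) * D * \<bar>\<tau>\<bar>)"
    using f unfolding vertical_order_def by metis
  define \<delta> where "\<delta> = pi / 2 * D - \<bar>\<theta>\<bar>"
  have b1: "cmod (f \<tau> * exp (of_real (\<theta> * \<tau>))) \<le> C * ((1 + \<bar>\<tau>\<bar>) powr p * exp (- \<delta> * \<bar>\<tau>\<bar>))" for \<tau>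
  proof -
    have "\<theta> * \<tau> \<le> \<bar>\<theta>\<bar> * \<bar>\<tau>\<bar>" by (metis abs_ge_self abs_mult)
    then have "cmod (f \<tau> * exp (of_real (\<theta> * \<tau>)))
        \<le> (C * (1 + \<bar>\<tau>\<bar>) powr p * exp (- (pi / 2) * D * \<bar>\<tau>\<bar>)) * exp (\<bar>\<theta>\<bar> * \<bar>\<tau>\<bar>)"
      unfolding norm_mult norm_exp_eq_Re using C by (intro mult_mono C(2)) auto
    also have "\<dots> = C * ((1 + \<bar>\<tau>\<bar>) powr p * (exp (- (pi / 2) * D * \<bar>\<tau>\<bar>) * exp (\<bar>\<theta>\<bar> * \<bar>\<tau>\<bar>)))"
      by (simp only: mult_ac)
    also have "exp (- (pi / 2) * D * \<bar>\<tau>\<bar>) * exp (\<bar>\<theta>\<bar> * \<bar>\<tau>\<bar>) = exp (- \<delta> * \<bar>\<tau>\<bar>)"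
      by (simp add: \<delta>_def algebra_simps flip: exp_add)
    finally show ?thesis .
  qed
  obtain q K where q: "q < -1" "K > 0" "\<And>\<tau>. (1 + \<bar>\<tau>\<bar>) powr p * exp (- \<delta> * \<bar>\<tau>\<bar>) \<le> K * (1 + \<bar>\<tau>\<bar>) powr q"
  proof (cases "\<bar>\<theta>\<bar> < pi / 2 * D")
    case True
    then have "\<delta> > 0" by (simp add: \<delta>_def)
    then obtain K where K: "K > 0" "\<And>u. u \<ge> 1 \<Longrightarrow> u powr (p + 2) \<le> K * exp (\<delta> * u)"
      using powr_le_exp[of \<delta> "p + 2"] by metis
    have "(1 + \<bar>\<tau>\<bar>) powr p * exp (- \<delta> * \<bar>\<tau>\<bar>) \<le> (K * exp \<delta>) * (1 + \<bar>\<tau>\<bar>) powr (-2)" for \<tau>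
    proof -
      let ?u = "1 + \<bar>\<tau>\<bar>"
      have "?u powr p * exp (- \<delta> * \<bar>\<tau>\<bar>) = ?u powr (p + 2) * exp (- \<delta> * \<bar>\<tau>\<bar>) * ?u powr (-2)"
        by (simp add: mult.commute[of _ "exp _"] mult.assoc flip: powr_add)
      also have "\<dots> \<le> K * exp (\<delta> * ?u) * exp (- \<delta> * \<bar>\<tau>\<bar>) * ?u powr (-2)"
        by (intro mult_right_mono K(2)) auto
      also have "\<dots> = K * (exp (\<delta> * ?u) * exp (- \<delta> * \<bar>\<tau>\<bar>)) * ?u powr (-2)" by (simp only: mult_ac)
      also have "exp (\<delta> * ?u) * exp (- \<delta> * \<bar>\<tau>\<bar>) = exp \<delta>"
        by (simp add: algebra_simps flip: exp_add)
      finally show ?thesis .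
    qed
    then show thesis using K(1) by (intro that[of "-2" "K * exp \<delta>"]) auto
  next
    case False
    with cases have "p < -1" "\<delta> = 0" by (auto simp: \<delta>_def)
    then show thesis by (intro that[of p 1]) auto
  qed
  have "integrable lborel (\<lambda>\<tau>. (C * K) * (1 + \<bar>\<tau>\<bar>) powr q)"
    by (intro integrable_mult_right integrable_one_plus_abs_powr q)
  then show ?thesis
  proof (rule Bochner_Integration.integrable_bound)
    show "AE \<tau> in lborel. norm (f \<tau> * exp (of_real (\<theta> * \<tau>))) \<le> norm ((C * K) * (1 + \<bar>\<tau>\<bar>) powr q)"
    proof (intro always_eventually allI)
      fix \<tau> :: real
      have "norm (f \<tau> * exp (of_real (\<theta> * \<tau>))) \<le> C * (K * (1 + \<bar>\<tau>\<bar>) powr q)"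
        using C(1) by (intro order_trans[OF b1] mult_left_mono q) auto
      then show "norm (f \<tau> * exp (of_real (\<theta> * \<tau>))) \<le> norm ((C * K) * (1 + \<bar>\<tau>\<bar>) powr q)"
        using C(1) q(2) by (simp add: mult.assoc)
    qed
  qed simp
qed

theorem integrable_I_kernel:
  assumes "log_Gamma_branch \<Lambda>" "I_admissible m n as bs \<theta>"
  shows "integrable lborel (\<lambda>\<tau>. I_kernel \<Lambda> m n as bs (\<i> * of_real \<tau>) * exp (of_real (\<theta> * \<tau>)))"
proof (rule integrable_if_vertical_order)
  show "(\<lambda>\<tau>. I_kernel \<Lambda> m n as bs (\<i> * of_real \<tau>)) \<in> borel_measurable borel"
    using assms by (intro borel_measurable_I_kernel) (auto simp: I_admissible_def)
  show "vertical_order (\<lambda>\<tau>. I_kernel \<Lambda> m n as bs (\<i> * of_real \<tau>)) (I_Omega as bs) (I_Delta m n as bs)"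
    using assms by (intro vertical_order_I_kernel) (auto simp: I_admissible_def)
  show "\<bar>\<theta>\<bar> < pi / 2 * I_Delta m n as bs \<or> \<bar>\<theta>\<bar> = pi / 2 * I_Delta m n as bs \<and> I_Omega as bs < -1"
    using assms(2) unfolding I_admissible_def I_abs_conv_def Let_def by auto
qed

section \<open>The Saigo operator under the contour integral\<close>

text \<open>
  The four new triples have exponent 1, so their branches are plain Gamma values and the new factors
  are those that the Saigo operator produces from \<open>t\<close> to the power \<open>- r\<close>.  At poles of a denominator factor
  \<open>x / 0 = 0\<close> agrees with \<open>1 / \<Gamma> = 0\<close>.
\<close>

lemma I_kernel_extended:
  fixes \<alpha> \<beta> \<gamma> \<rho> s :: complex and \<mu> \<tau> :: real
  assumes \<Lambda>: "log_Gamma_branch \<Lambda>" and len: "m \<le> length bs"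
    and \<mu>: "\<mu> > 0" and s: "s = \<i> * of_real \<tau>"
  defines "r \<equiv> \<rho> - of_real \<mu> * s"
  shows "I_kernel \<Lambda> m (n + 2) ((1 - \<gamma> - \<rho>, \<mu>, 1) # (1 - \<beta> - \<rho>, \<mu>, 1) # as)
           (bs @ [(1 - \<rho>, \<mu>, 1), (1 - \<alpha> - \<beta> - \<gamma> - \<rho>, \<mu>, 1)]) s
       = I_kernel \<Lambda> m n as bs s *
           (Gamma (\<beta> + r) * Gamma (\<gamma> + r) * rGamma r * rGamma (\<alpha> + \<beta> + \<gamma> + r))"
proof -
  have G: "Gamma_pow \<Lambda> c (- \<mu>) 1 s = Gamma (c - of_real \<mu> * s)" for c
  proof (cases "c - of_real \<mu> * s \<in> \<int>\<^sub>\<le>\<^sub>0")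
    case True
    then show ?thesis by (simp add: Gamma_pow_def Gamma_nonpos_Int)
  next
    case False
    have "exp (\<Lambda> c (- \<mu>) 1 s) = Gamma (c + of_real (- \<mu>) * s)"
      using \<mu> False by (intro log_Gamma_branchD[OF \<Lambda>]) (auto simp: s)
    then have "exp (\<Lambda> c (- \<mu>) 1 s) = Gamma (c - of_real \<mu> * s)" by simp
    with False show ?thesis by (simp add: Gamma_pow_def)
  qed
  have e: "\<gamma> + \<rho> - of_real \<mu> * s = \<gamma> + r" "\<beta> + \<rho> - of_real \<mu> * s = \<beta> + r" "\<rho> - of_real \<mu> * s = r"
     "\<alpha> + \<beta> + \<gamma> + \<rho> - of_real \<mu> * s = \<alpha> + \<beta> + \<gamma> + r"
     by (simp_all add: r_def)
  have 1: "1 - (1 - \<gamma> - \<rho>) = \<gamma> + \<rho>" "1 - (1 - \<beta> - \<rho>) = \<beta> + \<rho>" "1 - (1 - \<rho>) = \<rho>"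
     "1 - (1 - \<alpha> - \<beta> - \<gamma> - \<rho>) = \<alpha> + \<beta> + \<gamma> + \<rho>" by simp_all
  have t: "take m (bs @ ys) = take m bs" "drop m (bs @ ys) = drop m bs @ ys" for ys using len by simp_all
  show ?thesis
    unfolding I_kernel_def t
    by (simp add: 1 G e Gamma_def divide_inverse)
qed

theorem corollary3p3:
  fixes \<alpha> \<beta> \<gamma> \<rho> a :: complex and \<mu> \<theta> x :: real
    and m n :: nat and as bs :: "triple list"
    and \<Lambda> :: "complex \<Rightarrow> real \<Rightarrow> real \<Rightarrow> complex \<Rightarrow> complex"
  defines "as' \<equiv> (1 - \<gamma> - \<rho>, \<mu>, 1) # (1 - \<beta> - \<rho>, \<mu>, 1) # as"
    and "bs' \<equiv> bs @ [(1 - \<rho>, \<mu>, 1), (1 - \<alpha> - \<beta> - \<gamma> - \<rho>, \<mu>, 1)]"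
  assumes "log_Gamma_branch \<Lambda>"
    and "a \<noteq> 0" and "a = rcis (cmod a) \<theta>"
    and "I_admissible m n as bs \<theta>"
    and "I_admissible m (n + 2) as' bs' \<theta>"
    and "Re \<alpha> > 0" and "\<mu> > 0" and "Re \<rho> > max (Re (- \<beta>)) (Re (- \<gamma>))"
    and "x > 0"
  shows "Saigo_right \<alpha> \<beta> \<gamma>
           (\<lambda>t. of_real t powr (- \<rho>) * I_function \<Lambda> m n as bs (a * of_real (t powr (- \<mu>))) \<theta>) x =
         of_real x powr (- \<beta> - \<rho>) *
           I_function \<Lambda> m (n + 2) as' bs' (a * of_real (x powr (- \<mu>))) \<theta>"
proof -
  have \<alpha>: "Re \<alpha> > 0" and \<mu>: "\<mu> > 0" and x: "x > 0" by fact+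
  have re: "Re (\<beta> + \<rho>) > 0" "Re (\<gamma> + \<rho>) > 0" using assms(10) by auto
  have len: "m \<le> length bs" using assms(6) by (auto simp: I_admissible_def I_params_def)
  let ?W = "Saigo_weight \<alpha> \<beta> \<gamma> x"
  \<comment> \<open>\<open>k\<close> is the part of the integrand that is free of \<open>t\<close>, and \<open>R\<close> the multiplier coming from the operator.\<close>
  define L where "L = ln (cmod a)"
  define r where "r \<tau> = \<rho> - of_real \<mu> * (\<i> * of_real \<tau>)" for \<tau> :: real
  define k where "k \<tau> = I_kernel \<Lambda> m n as bs (\<i> * of_real \<tau>) * exp (of_real (\<theta> * \<tau>)) * exp (- (\<i> * of_real (\<tau> * L)))" for \<tau> :: real
  define R where "R \<tau> = Gamma (\<beta> + r \<tau>) * Gamma (\<gamma> + r \<tau>) * rGamma (r \<tau>) * rGamma (\<alpha> + \<beta> + \<gamma> + r \<tau>)" for \<tau> :: real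
  have k: "integrable lborel k"
  proof (rule Bochner_Integration.integrable_bound[OF integrable_I_kernel[OF assms(3,6)]])
    have [measurable]: "(\<lambda>\<tau>. I_kernel \<Lambda> m n as bs (\<i> * of_real \<tau>)) \<in> borel_measurable borel"
      using assms(3,6) by (intro borel_measurable_I_kernel) (auto simp: I_admissible_def)
    show "k \<in> borel_measurable lborel" unfolding k_def[abs_def] by measurable
  qed (simp add: k_def norm_mult)
  have mellin: "exp (- (\<i> * of_real \<tau>) * (of_real (ln (cmod (a * of_real (t powr (- \<mu>))))) + \<i> * of_real \<theta>))
      = exp (of_real (\<theta> * \<tau>)) * exp (- (\<i> * of_real (\<tau> * L))) * of_real t powr (of_real \<mu> * (\<i> * of_real \<tau>))"
    if "t > 0" for t \<tau>
  proof -
    have l: "ln (cmod (a * of_real (t powr (- \<mu>)))) = L - \<mu> * ln t"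
      using that \<open>a \<noteq> 0\<close> by (simp add: norm_mult L_def ln_mult ln_powr)
    have p: "of_real t powr (of_real \<mu> * (\<i> * of_real \<tau>)) = exp (of_real \<mu> * (\<i> * of_real \<tau>) * of_real (ln t))"
      using that by (simp add: powr_def Ln_of_real)
    show ?thesis
      unfolding l p by (simp add: algebra_simps flip: exp_add)
  qed
  have I1: "I_function \<Lambda> m n as bs (a * of_real (t powr (- \<mu>))) \<theta>
      = 1 / (2 * of_real pi) * (\<integral>\<tau>. k \<tau> * of_real t powr (of_real \<mu> * (\<i> * of_real \<tau>)) \<partial>lborel)" if "t > 0" for t
  proof -
    have "I_function \<Lambda> m n as bs (a * of_real (t powr (- \<mu>))) \<theta>
       = 1 / (2 * of_real pi * \<i>) * (\<integral>\<tau>. k \<tau> * of_real t powr (of_real \<mu> * (\<i> * of_real \<tau>)) * \<i> \<partial>lborel)"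
      unfolding I_function_def Let_def mellin[OF that] k_def by (simp only: mult_ac)
    then show ?thesis by simp
  qed
  have I2: "I_function \<Lambda> m (n + 2) as' bs' (a * of_real (x powr (- \<mu>))) \<theta>
      = 1 / (2 * of_real pi) * (\<integral>\<tau>. k \<tau> * R \<tau> * of_real x powr (of_real \<mu> * (\<i> * of_real \<tau>)) \<partial>lborel)"
  proof -
    have "I_function \<Lambda> m (n + 2) as' bs' (a * of_real (x powr (- \<mu>))) \<theta>
       = 1 / (2 * of_real pi * \<i>) * (\<integral>\<tau>. k \<tau> * R \<tau> * of_real x powr (of_real \<mu> * (\<i> * of_real \<tau>)) * \<i> \<partial>lborel)"
      unfolding I_function_def Let_def mellin[OF x] as'_def bs'_def
        I_kernel_extended[OF assms(3) len \<mu> refl] k_def R_def r_def by (simp only: mult_ac)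
    then show ?thesis by simp
  qed
  have int: "integrable lborel (\<lambda>t. indicator {x<..} t *\<^sub>R (?W t * of_real t powr (- r \<tau>)))"
    and val: "(\<integral>t. indicator {x<..} t *\<^sub>R (?W t * of_real t powr (- r \<tau>)) \<partial>lborel)
        = Gamma \<alpha> * (of_real x powr (- \<beta> - r \<tau>) * R \<tau>)" for \<tau>
    using Saigo_weight_power_integral[of \<alpha> \<beta> "r \<tau>" \<gamma> x] \<alpha> re x
    unfolding set_integrable_def set_lebesgue_integral_def R_def by (auto simp: r_def)
  \<comment> \<open>Since \<open>r \<tau>\<close> has constant real part, the norm of the double integrand is a product.\<close>
  define F where "F t \<tau> = (indicator {x<..} t *\<^sub>R (?W t * of_real t powr (- r \<tau>))) * k \<tau>" for t \<tau> :: real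
  have nF: "norm (F t \<tau>) = norm (indicator {x<..} t *\<^sub>R (?W t * of_real t powr (- \<rho>))) * norm (k \<tau>)" for t \<tau>
    using x by (auto simp: F_def norm_mult norm_powr_real_powr r_def split: split_indicator)
  have mF: "case_prod F \<in> borel_measurable (lborel \<Otimes>\<^sub>M lborel)"
  proof -
    have "(\<lambda>(t, \<tau>). complex_of_real t powr (- r \<tau>)) \<in> borel_measurable (lborel \<Otimes>\<^sub>M lborel)"
    proof -
      \<comment> \<open>The principal logarithm on the real line, written out to exhibit joint measurability.\<close>
      have "(\<lambda>(t, \<tau>). complex_of_real t powr (- r \<tau>)) = (\<lambda>(t, \<tau>). of_real t powr (- \<rho>) *
          (if t = 0 then 0 else exp (of_real \<mu> * (\<i> * of_real \<tau>) *
            (of_real (ln \<bar>t\<bar>) + (if t < 0 then of_real pi * \<i> else 0)))))"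
        by (auto simp: fun_eq_iff powr_def Ln_of_real' r_def algebra_simps simp flip: exp_add)
      then show ?thesis by simp
    qed
    moreover have "k \<in> borel_measurable borel" using borel_measurable_integrable[OF k] by simp
    ultimately show ?thesis unfolding F_def[abs_def] by (simp add: case_prod_unfold)
  qed
  have "integrable (lborel \<Otimes>\<^sub>M lborel) (case_prod F)"
  proof (rule lborel_pair.Fubini_integrable[OF mF])
    have "integrable lborel (\<lambda>t. norm (indicator {x<..} t *\<^sub>R (?W t * of_real t powr (- \<rho>))) * (\<integral>\<tau>. norm (k \<tau>) \<partial>lborel))"
      using int[of 0] by (intro integrable_mult_left integrable_norm) (simp add: r_def)
    then show "integrable lborel (\<lambda>t. \<integral>\<tau>. norm (case_prod F (t, \<tau>)) \<partial>lborel)"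
      by (simp add: nF)
    show "AE t in lborel. integrable lborel (\<lambda>\<tau>. case_prod F (t, \<tau>))"
    proof (intro always_eventually allI)
      fix t :: real
      have m: "(\<lambda>\<tau>. case_prod F (t, \<tau>)) \<in> borel_measurable lborel" using mF by measurable
      have "integrable lborel (\<lambda>\<tau>. norm (indicator {x<..} t *\<^sub>R (?W t * of_real t powr (- \<rho>))) * norm (k \<tau>))"
        using k by (intro integrable_mult_right integrable_norm)
      then show "integrable lborel (\<lambda>\<tau>. case_prod F (t, \<tau>))"
        by (rule Bochner_Integration.integrable_bound[OF _ m]) (simp add: nF)
    qed
  qed
  from lborel_pair.Fubini_integral[OF this]
  have swap: "(\<integral>t. (\<integral>\<tau>. F t \<tau> \<partial>lborel) \<partial>lborel) = (\<integral>\<tau>. (\<integral>t. F t \<tau> \<partial>lborel) \<partial>lborel)" by simp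
  let ?c = "1 / (2 * of_real pi) :: complex"
  have "Saigo_right \<alpha> \<beta> \<gamma>
      (\<lambda>t. of_real t powr (- \<rho>) * I_function \<Lambda> m n as bs (a * of_real (t powr (- \<mu>))) \<theta>) x
    = 1 / Gamma \<alpha> * (\<integral>t. ?c * (\<integral>\<tau>. F t \<tau> \<partial>lborel) \<partial>lborel)"
    unfolding Saigo_right_def set_lebesgue_integral_def
  proof (intro arg_cong2[of _ _ _ _ "(*)"] refl Bochner_Integration.integral_cong)
    fix t :: real
    show "indicator {x<..} t *\<^sub>R (of_real (t - x) powr (\<alpha> - 1) * of_real t powr (- \<alpha> - \<beta>) *
        Gauss_2F1 (\<alpha> + \<beta>) (- \<gamma>) \<alpha> (of_real (1 - x / t)) *
        (of_real t powr (- \<rho>) * I_function \<Lambda> m n as bs (a * of_real (t powr (- \<mu>))) \<theta>))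
      = ?c * (\<integral>\<tau>. F t \<tau> \<partial>lborel)"
    proof (cases "t > x")
      case True
      then have t: "t > 0" using x by simp
      have "F t \<tau> = (?W t * of_real t powr (- \<rho>)) * (k \<tau> * of_real t powr (of_real \<mu> * (\<i> * of_real \<tau>)))" for \<tau>
        using True by (simp add: F_def r_def powr_add[symmetric] algebra_simps)
      then have "(\<integral>\<tau>. F t \<tau> \<partial>lborel) = (?W t * of_real t powr (- \<rho>)) *
          (\<integral>\<tau>. k \<tau> * of_real t powr (of_real \<mu> * (\<i> * of_real \<tau>)) \<partial>lborel)"
        by simp
      then show ?thesis using True by (simp add: I1[OF t] Saigo_weight_def)
    qed (simp add: F_def)
  qed
  also have "\<dots> = ?c * (1 / Gamma \<alpha> * (\<integral>\<tau>. (\<integral>t. F t \<tau> \<partial>lborel) \<partial>lborel))"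
    by (simp add: swap)
  also have "(\<integral>\<tau>. (\<integral>t. F t \<tau> \<partial>lborel) \<partial>lborel)
      = (\<integral>\<tau>. (Gamma \<alpha> * of_real x powr (- \<beta> - \<rho>)) * (k \<tau> * R \<tau> * of_real x powr (of_real \<mu> * (\<i> * of_real \<tau>))) \<partial>lborel)"
  proof (intro Bochner_Integration.integral_cong refl)
    fix \<tau> :: real
    have "(\<integral>t. F t \<tau> \<partial>lborel) = Gamma \<alpha> * (of_real x powr (- \<beta> - r \<tau>) * R \<tau>) * k \<tau>"
      by (simp only: F_def integral_mult_left_zero val)
    also have "- \<beta> - r \<tau> = (- \<beta> - \<rho>) + of_real \<mu> * (\<i> * of_real \<tau>)" by (simp add: r_def)
    finally show "(\<integral>t. F t \<tau> \<partial>lborel)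
      = (Gamma \<alpha> * of_real x powr (- \<beta> - \<rho>)) * (k \<tau> * R \<tau> * of_real x powr (of_real \<mu> * (\<i> * of_real \<tau>)))"
      unfolding powr_add by (simp only: mult_ac)
  qed
  also have "?c * (1 / Gamma \<alpha> * \<dots>) = of_real x powr (- \<beta> - \<rho>) *
      I_function \<Lambda> m (n + 2) as' bs' (a * of_real (x powr (- \<mu>))) \<theta>"
  proof -
    have "Gamma \<alpha> \<noteq> 0" using not_nonpos_Int_if_Re_pos[OF \<alpha>] by (simp add: Gamma_eq_zero_iff)
    then show ?thesis unfolding I2 by simp
  qed
  finally show ?thesis .
qed

end
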